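(* Let $x \in C_n[0,T]$ with $\dot x \in P_n[0,T]$, and suppose that the interval $[0,T]$ may be divided into a finite number of intervals, in every one of which each phase trajectory $x_i(t)$, $i=1,\dots,n$, is either identically equal to zero or retains a certain sign. Then the functional $$\varphi(x) = \int_0^T h^2\big(x(t),\dot x(t)\big)\,dt$$ is superdifferentiable at $x$, i.e. for every $g \in C_n[0,T]$ with $\dot g \in P_n[0,T]$ $$\frac{\partial \varphi(x)}{\partial g} = \lim_{\alpha \downarrow 0} \frac{1}{\alpha}\big(\varphi(x+\alpha g)-\varphi(x)\big) = \min_{w \in \overline\partial \varphi(x)} w(g),$$ where the set $\overline\partial\varphi(x)$ (a convex, weakly* compact subset of $\big(C_n[0,T],\|\cdot\|_{L_2^n[0,T]}\big)^*$, as required by the definition of a superdifferential) is of the form $$\overline \partial \varphi(x) = \Big\{ w \in \big(C_n[0,T],\|\cdot\|_{L_2^n[0,T]}\big)^* \ \Big|\ w(g) = \int_0^T \langle w_1(t), g(t)\rangle\,dt + \int_0^T \langle w_2(t), \dot g(t)\rangle\,dt \quad \forall g \in C_n[0,T],\ \dot g \in P_n[0,T],$$ $$w_1, w_2 \in L_\infty^n[0,T],\quad [w_1(t),w_2(t)] \in \overline\partial h^2(x(t),\dot x(t)) \ \text{ for a.e. } t\in[0,T] \Big\}.$$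
   Context: $C_n[0,T]$ is the space of continuous $n$-dimensional vector-functions on $[0,T]$; $P_n[0,T]$ is the space of piecewise continuous and bounded $n$-dimensional vector-functions on $[0,T]$. Trajectories $x$ are continuous and piecewise continuously differentiable with bounded derivative; at a point $t_0 \in [0,T)$ of nondifferentiability $\dot x(t_0)$ denotes the right-hand derivative, and $\dot x(T)$ the left-hand derivative. $L_2^n[0,T]$ (resp. $L_\infty^n[0,T]$) is the space of square-summable (resp. essentially bounded measurable) $n$-dimensional vector-functions. The dual space $\big(C_n[0,T],\|\cdot\|_{L_2^n[0,T]}\big)^*$ is identified with $L_2^n[0,T]$. For $x\in\mathbb R^n$ put $|x|=\sum_{j=1}^n|x_j|$. Let $m\le n$, let $A$ be a constant real $n\times n$ matrix with rows $A_1,\dots,A_n$, and let $\overline a_1,\dots,\overline a_m>0$. For $x\in\mathbb R^n$ let $F_i(x)=\{A_ix+r|x| : r\in[-\overline a_i,\overline a_i]\}$ for $i=1,\dots,m$ and $F_i(x)=\{A_ix\}$ for $i=m+1,\dots,n$. The support function is $c(F_i(x),\psi_i)=\sup_{f\in F_i(x)} f\psi_i$, so $c(F_i(x),\psi_i)=\psi_iA_ix+\overline a_i|x||\psi_i|$ for $i\le m$ and $c(F_i(x),\psi_i)=\psi_iA_ix$ for $i>m$. With $S_1=\{-1,1\}\subset\mathbb R$ put $$\ell_i(\psi_i,x,z)=z_i\psi_i-c(F_i(x),\psi_i),\qquad h_i(x,z)=\max_{\psi_i\in S_1}\max\{0,\ell_i(\psi_i,x,z)\},\qquad h=(h_1,\dots,h_n)',$$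 for $x,z\in\mathbb R^n$, and $h^2(x,z)=\sum_{i=1}^n h_i(x,z)^2$. Superdifferential in finite dimensions: a function $k(x,z)$ on $\mathbb R^n\times\mathbb R^n$ is superdifferentiable at $(x,z)$ if there is a convex compact set $\overline\partial k(x,z)\subset\mathbb R^n\times\mathbb R^n$ (its superdifferential) such that for every $d=[d_1,d_2]\in\mathbb R^n\times\mathbb R^n$ $$\lim_{\alpha\downarrow0}\frac1\alpha\big(k(x+\alpha d_1,z+\alpha d_2)-k(x,z)\big)=\min_{w\in\overline\partial k(x,z)}\langle w,d\rangle .$$ $\overline\partial h^2(x,z)$ denotes the superdifferential of $h^2$ at $(x,z)$ in this sense. Superdifferential of a functional: consider $C_n[0,T]$ with the $L_2^n[0,T]$ norm. A functional $I$ is superdifferentiable at $x$ if there is a convex weakly* compact set $\overline\partial I(x)\subset\big(C_n[0,T],\|\cdot\|_{L_2^n[0,T]}\big)^*$ (its superdifferential) such that $\lim_{\alpha\downarrow0}\frac1\alpha(I(x+\alpha g)-I(x))=\min_{w\in\overline\partial I(x)}w(g)$ for all directions $g$.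
   Formalization: The dual is taken for the L2 norm of the pair (g, g') instead of the L2 norm of g alone, with pointwise convergence on trajectories as weak* topology; with the L2 norm of g alone the displayed set can be empty (n=m=1, A=0, a=1, T=1/4, x=1/4+t). *)

theory Defs
  imports "HOL-Analysis.Analysis"
begin

section \<open>The integrand\<close>

text \<open>Coordinates are indexed by a finite type \<open>'n\<close>. Since such a type carries no order, the
  rows \<open>i = 1, \<dots>, m\<close> whose right-hand side is an interval are given by an arbitrary
  subset \<open>I\<close> of the indices (so \<open>m\<close> is the cardinality of \<open>I\<close>), the remaining rows being
  single-valued.\<close>

definition norm1 :: "real^'n \<Rightarrow> real" where
  "norm1 x = (\<Sum>j\<in>UNIV. \<bar>x $ j\<bar>)"

definition rhs_set :: "real^'n^'n \<Rightarrow> 'n set \<Rightarrow> ('n \<Rightarrow> real) \<Rightarrow> 'n \<Rightarrow> real^'n \<Rightarrow> real set" where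
  "rhs_set A I abar i x =
     (if i \<in> I then {row i A \<bullet> x + r * norm1 x | r. r \<in> {- abar i..abar i}}
      else {row i A \<bullet> x})"

definition support_fun :: "real set \<Rightarrow> real \<Rightarrow> real" where
  "support_fun F \<psi> = (SUP f\<in>F. f * \<psi>)"

definition ell_fun ::
    "real^'n^'n \<Rightarrow> 'n set \<Rightarrow> ('n \<Rightarrow> real) \<Rightarrow> 'n \<Rightarrow> real \<Rightarrow> real^'n \<Rightarrow> real^'n \<Rightarrow> real" where
  "ell_fun A I abar i \<psi> x z = z $ i * \<psi> - support_fun (rhs_set A I abar i x) \<psi>"

definition h_fun ::
    "real^'n^'n \<Rightarrow> 'n set \<Rightarrow> ('n \<Rightarrow> real) \<Rightarrow> real^'n \<Rightarrow> real^'n \<Rightarrow> real^'n" where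
  "h_fun A I abar x z = (\<chi> i. MAX \<psi>\<in>{-1, 1}. max 0 (ell_fun A I abar i \<psi> x z))"

definition h_sq ::
    "real^'n^'n \<Rightarrow> 'n set \<Rightarrow> ('n \<Rightarrow> real) \<Rightarrow> (real^'n) \<times> (real^'n) \<Rightarrow> real" where
  "h_sq A I abar = (\<lambda>(x, z). \<Sum>i\<in>UNIV. (h_fun A I abar x z $ i)\<^sup>2)"

section \<open>Superdifferentials in finite dimensions\<close>

definition is_superdifferential :: "('a::euclidean_space \<Rightarrow> real) \<Rightarrow> 'a \<Rightarrow> 'a set \<Rightarrow> bool" where
  "is_superdifferential k p D \<longleftrightarrow>
     convex D \<and> compact D \<and>
     (\<forall>d. \<exists>w. is_arg_min (\<lambda>v. v \<bullet> d) (\<lambda>v. v \<in> D) w \<and>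
       ((\<lambda>\<alpha>. (k (p + \<alpha> *\<^sub>R d) - k p) / \<alpha>) \<longlongrightarrow> w \<bullet> d) (at_right 0))"

text \<open>A convex compact set is determined by its support function, so there is at most one
  superdifferential; for a function that is not superdifferentiable at \<open>p\<close> the value of
  \<open>superdifferential k p\<close> is unspecified.\<close>

definition superdifferential :: "('a::euclidean_space \<Rightarrow> real) \<Rightarrow> 'a \<Rightarrow> 'a set" where
  "superdifferential k p = (THE D. is_superdifferential k p D)"

section \<open>Trajectories\<close>

text \<open>Functions on \<open>[0,T]\<close> are total functions of which only the values on \<open>[0,T]\<close> are used.\<close>

definition pw_continuous_bounded :: "real \<Rightarrow> (real \<Rightarrow> 'b::real_normed_vector) set" where
  "pw_continuous_bounded T =
     {f. bounded (f ` {0..T}) \<and> (\<exists>S. finite S \<and> continuous_on ({0..T} - S) f)}"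

definition traj_deriv :: "real \<Rightarrow> (real \<Rightarrow> 'b::real_normed_vector) \<Rightarrow> real \<Rightarrow> 'b" where
  "traj_deriv T x t =
     vector_derivative x (if t < T then at_right t else at_left t)"

text \<open>The class of \<open>x \<in> C\<^sub>n[0,T]\<close> with \<open>x' \<in> P\<^sub>n[0,T]\<close>. The exceptional finite set hidden in
  \<^const>\<open>piecewise_C1_differentiable_on\<close> may contain the end points, so nothing is assumed
  outside \<open>[0,T]\<close>; the one-sided derivatives that define \<^const>\<open>traj_deriv\<close> are required
  to exist everywhere.\<close>

definition trajectories :: "real \<Rightarrow> (real \<Rightarrow> 'b::real_normed_vector) set" where
  "trajectories T =
     {x. x piecewise_C1_differentiable_on {0..T} \<and>
         (\<forall>t\<in>{0..<T}. x differentiable (at_right t)) \<and>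
         x differentiable (at_left T) \<and>
         traj_deriv T x \<in> pw_continuous_bounded T}"

definition L_infinity :: "real \<Rightarrow> (real \<Rightarrow> 'b::euclidean_space) set" where
  "L_infinity T =
     {w. w \<in> borel_measurable (lebesgue_on {0..T}) \<and>
         (\<exists>C. AE t in lebesgue_on {0..T}. norm (w t) \<le> C)}"

section \<open>Superdifferentials of functionals on trajectories\<close>

text \<open>A functional \<open>w(g) = \<integral> \<langle>w\<^sub>1, g\<rangle> + \<integral> \<langle>w\<^sub>2, g'\<rangle>\<close> is in general not bounded with respect to the
  \<open>L\<^sub>2\<close> norm of \<open>g\<close> alone: even for smooth \<open>w\<^sub>2\<close>, integration by parts produces the values of
  \<open>g\<close> at the end points. The norm on trajectories is therefore the \<open>L\<^sub>2\<close> norm of the pair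
  \<open>(g, g')\<close>, the two functions on which such functionals act.\<close>

definition traj_norm :: "real \<Rightarrow> (real \<Rightarrow> 'b::euclidean_space) \<Rightarrow> real" where
  "traj_norm T g =
     sqrt ((LINT t|lebesgue_on {0..T}. (norm (g t))\<^sup>2) +
           (LINT t|lebesgue_on {0..T}. (norm (traj_deriv T g t))\<^sup>2))"

text \<open>Functionals are \<^const>\<open>extensional\<close>, i.e. fixed outside the trajectories, so that equality
  of functionals means equality on trajectories.\<close>

definition traj_dual :: "real \<Rightarrow> ((real \<Rightarrow> 'b::euclidean_space) \<Rightarrow> real) set" where
  "traj_dual T =
     {w \<in> extensional (trajectories T).
        (\<forall>f\<in>trajectories T. \<forall>g\<in>trajectories T. w (\<lambda>t. f t + g t) = w f + w g) \<and>
        (\<forall>c. \<forall>g\<in>trajectories T. w (\<lambda>t. c *\<^sub>R g t) = c * w g) \<and>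
        (\<exists>C. \<forall>g\<in>trajectories T. \<bar>w g\<bar> \<le> C * traj_norm T g)}"

definition weak_star_topology ::
    "real \<Rightarrow> ((real \<Rightarrow> 'b::euclidean_space) \<Rightarrow> real) topology" where
  "weak_star_topology T =
     subtopology (product_topology (\<lambda>_. euclideanreal) (trajectories T)) (traj_dual T)"

definition convex_functionals ::
    "real \<Rightarrow> ((real \<Rightarrow> 'b::euclidean_space) \<Rightarrow> real) set \<Rightarrow> bool" where
  "convex_functionals T W \<longleftrightarrow>
     (\<forall>v\<in>W. \<forall>w\<in>W. \<forall>u\<in>{0..1}.
        (\<lambda>g\<in>trajectories T. (1 - u) * v g + u * w g) \<in> W)"

definition is_functional_superdifferential ::
    "real \<Rightarrow> ((real \<Rightarrow> 'b::euclidean_space) \<Rightarrow> real) \<Rightarrow> (real \<Rightarrow> 'b)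
      \<Rightarrow> ((real \<Rightarrow> 'b) \<Rightarrow> real) set \<Rightarrow> bool" where
  "is_functional_superdifferential T J x W \<longleftrightarrow>
     W \<subseteq> traj_dual T \<and> convex_functionals T W \<and> compactin (weak_star_topology T) W \<and>
     (\<forall>g\<in>trajectories T. \<exists>w. is_arg_min (\<lambda>v. v g) (\<lambda>v. v \<in> W) w \<and>
       ((\<lambda>\<alpha>. (J (\<lambda>t. x t + \<alpha> *\<^sub>R g t) - J x) / \<alpha>) \<longlongrightarrow> w g) (at_right 0))"

section \<open>The functional and the candidate superdifferential\<close>

definition phi ::
    "real^'n^'n \<Rightarrow> 'n set \<Rightarrow> ('n \<Rightarrow> real) \<Rightarrow> real \<Rightarrow> (real \<Rightarrow> real^'n) \<Rightarrow> real" where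
  "phi A I abar T x = (LINT t|lebesgue_on {0..T}. h_sq A I abar (x t, traj_deriv T x t))"

definition phi_superdifferential ::
    "real^'n^'n \<Rightarrow> 'n set \<Rightarrow> ('n \<Rightarrow> real) \<Rightarrow> real \<Rightarrow> (real \<Rightarrow> real^'n)
      \<Rightarrow> ((real \<Rightarrow> real^'n) \<Rightarrow> real) set" where
  "phi_superdifferential A I abar T x =
     {w \<in> traj_dual T. \<exists>w1 w2. w1 \<in> L_infinity T \<and> w2 \<in> L_infinity T \<and>
        (\<forall>g\<in>trajectories T.
           w g = (LINT t|lebesgue_on {0..T}. w1 t \<bullet> g t) +
                 (LINT t|lebesgue_on {0..T}. w2 t \<bullet> traj_deriv T g t)) \<and>
        (AE t in lebesgue_on {0..T}.
           (w1 t, w2 t) \<in> superdifferential (h_sq A I abar) (x t, traj_deriv T x t))}"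

definition finitely_many_sign_intervals :: "real \<Rightarrow> (real \<Rightarrow> real^'n) \<Rightarrow> bool" where
  "finitely_many_sign_intervals T x \<longleftrightarrow>
     (\<exists>\<J>. finite \<J> \<and> partition_on {0..T} \<J> \<and>
       (\<forall>J\<in>\<J>. is_interval J \<and>
         (\<forall>i. (\<forall>t\<in>J. x t $ i = 0) \<or> (\<forall>t\<in>J. x t $ i > 0) \<or> (\<forall>t\<in>J. x t $ i < 0))))"

end

theory Submission
  imports Defs
begin

text \<open>Write \<open>y = (x, x')\<close>. Each \<open>h\<^sub>i\<^sup>2\<close> is \<open>(max 0 s)\<^sup>2\<close>, a differentiable function of
  \<open>s = \<bar>x'\<^sub>i - A\<^sub>i x\<bar> - a\<^sub>i \<bar>x\<bar>\<close>, and where it is nonzero the first absolute value is differentiable. Hence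
  the directional derivative of \<open>h\<^sup>2\<close> at \<open>y\<close> is \<open>\<langle>m, d\<^sub>1\<rangle> + \<langle>q, d\<^sub>2\<rangle> - \<Sum>\<^sub>j r\<^sub>j \<bar>d\<^sub>1\<^sub>j\<bar>\<close> with \<open>r \<ge> 0\<close>
  supported on the vanishing coordinates of \<open>x\<close>, and the superdifferential is the box
  \<open>{(w\<^sub>1, q) | \<bar>w\<^sub>1\<^sub>j - m\<^sub>j\<bar> \<le> r\<^sub>j}\<close>. Dominated convergence carries the directional derivative over to
  the integral functional, and the minimum over the measurable selections \<open>w\<^sub>1\<close> is attained at
  \<open>w\<^sub>1\<^sub>j = m\<^sub>j - r\<^sub>j sgn g\<^sub>j\<close>. For weak* compactness, write \<open>w\<^sub>1\<^sub>j = m\<^sub>j + r\<^sub>j s\<^sub>j\<close> with \<open>\<bar>s\<^sub>j\<bar> \<le> 1\<close>: the set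
  of functionals is a continuous affine image of a power of the unit ball of the dual of \<open>L\<^sub>1\<close>, which is
  compact by Tychonoff's theorem and consists of such \<open>s\<^sub>j\<close> by the Radon-Nikodym theorem.\<close>

section \<open>The superdifferential of the integrand\<close>

text \<open>Both sets have the same minimum in every direction, namely the directional derivative. A
  point of one set outside the other, which is closed and convex, would be separated from it by a
  hyperplane, and the minima along its normal \<open>d\<close> would differ.\<close>

lemma is_superdifferential_unique:
  assumes D: "is_superdifferential k p D" and E: "is_superdifferential k p E"
  shows "D = E"
proof -
  have sub: "D \<subseteq> E" if D: "is_superdifferential k p D" and E: "is_superdifferential k p E" for D E
  proof
    fix y assume y: "y \<in> D"
    show "y \<in> E"
    proof (rule ccontr)
      assume "y \<notin> E"
      then obtain d b where d: "d \<bullet> y < b" "\<And>v. v \<in> E \<Longrightarrow> b < d \<bullet> v"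
        using separating_hyperplane_closed_point[of E y] E
        by (auto simp: is_superdifferential_def compact_imp_closed)
      let ?lim = "\<lambda>l. ((\<lambda>\<alpha>. (k (p + \<alpha> *\<^sub>R d) - k p) / \<alpha>) \<longlongrightarrow> l) (at_right 0)"
      obtain v where v: "is_arg_min (\<lambda>v. v \<bullet> d) (\<lambda>v. v \<in> D) v" "?lim (v \<bullet> d)"
        using D by (auto simp: is_superdifferential_def)
      obtain w where w: "is_arg_min (\<lambda>v. v \<bullet> d) (\<lambda>v. v \<in> E) w" "?lim (w \<bullet> d)"
        using E by (auto simp: is_superdifferential_def)
      have "v \<bullet> d = w \<bullet> d"
        using tendsto_unique[OF _ v(2) w(2)] by simp
      moreover have "v \<bullet> d \<le> y \<bullet> d" "w \<in> E"
        using v w y by (auto simp: is_arg_min_linorder)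
      ultimately show False
        using d by (fastforce simp: inner_commute)
    qed
  qed
  from sub[OF D E] sub[OF E D] show ?thesis by blast
qed

lemma superdifferential_eqI: "is_superdifferential k p D \<Longrightarrow> superdifferential k p = D"
  unfolding superdifferential_def by (rule the_equality) (use is_superdifferential_unique in blast)+

section \<open>Closed form of the integrand\<close>

definition dev :: "real^'n^'n \<Rightarrow> 'n \<Rightarrow> (real^'n) \<times> (real^'n) \<Rightarrow> real" where
  "dev A i = (\<lambda>(x, z). z $ i - row i A \<bullet> x)"

text \<open>Single-valued rows count as intervals of radius 0, so that one formula covers both kinds
  of row.\<close>

definition radius :: "'n set \<Rightarrow> ('n \<Rightarrow> real) \<Rightarrow> 'n \<Rightarrow> real" where
  "radius I abar i = (if i \<in> I then abar i else 0)"

text \<open>For \<open>b = radius I abar\<close> with positive \<open>abar\<close> this is the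
  larger of the values of \<open>ell_fun\<close> at \<psi> = 1 and \<psi> = -1; where positive, it
  is the distance from \<open>z $ i\<close> to the right-hand side set of row
  \<open>i\<close>.\<close>

definition gap :: "real^'n^'n \<Rightarrow> ('n \<Rightarrow> real) \<Rightarrow> 'n \<Rightarrow> (real^'n) \<times> (real^'n) \<Rightarrow> real" where
  "gap A b i y = \<bar>dev A i y\<bar> - b i * norm1 (fst y)"

lemma norm1_nonneg: "0 \<le> norm1 x"
  by (simp add: norm1_def sum_nonneg)

text \<open>The supremum is attained at the end point \<open>r = abar i * \<psi>\<close>; the
  product with \<psi> contains \<open>\<psi> * \<psi> = 1\<close>, so the radius term does not see
  the sign.\<close>

lemma support_fun_rhs_set:
  assumes "\<forall>i\<in>I. abar i > 0" "\<bar>\<psi>\<bar> = 1"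
  shows "support_fun (rhs_set A I abar i x) \<psi> = row i A \<bullet> x * \<psi> + radius I abar i * norm1 x"
proof (cases "i \<in> I")
  case True
  have "(SUP f\<in>rhs_set A I abar i x. f * \<psi>) = (row i A \<bullet> x + abar i * \<psi> * norm1 x) * \<psi>"
  proof (intro cSup_eq_maximum)
    show "(row i A \<bullet> x + abar i * \<psi> * norm1 x) * \<psi> \<in> (\<lambda>f. f * \<psi>) ` rhs_set A I abar i x"
      using True assms by (fastforce simp: rhs_set_def abs_if split: if_splits)
    fix v assume "v \<in> (\<lambda>f. f * \<psi>) ` rhs_set A I abar i x"
    then obtain r where r: "r \<in> {- abar i..abar i}" and v: "v = (row i A \<bullet> x + r * norm1 x) * \<psi>"
      using True unfolding rhs_set_def by (simp only: if_True) blast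
    have "\<psi> = 1 \<or> \<psi> = -1" using assms(2) by linarith
    moreover have "r * norm1 x \<le> abar i * norm1 x" "- (abar i * norm1 x) \<le> r * norm1 x"
      using r mult_right_mono[OF _ norm1_nonneg, of r "abar i" x]
        mult_right_mono[OF _ norm1_nonneg, of "- abar i" r x] by auto
    ultimately show "v \<le> (row i A \<bullet> x + abar i * \<psi> * norm1 x) * \<psi>"
      unfolding v by auto
  qed
  moreover have "\<psi> * \<psi> = 1" using assms(2) by (auto simp: abs_if split: if_splits)
  ultimately show ?thesis
    using True by (simp add: support_fun_def radius_def algebra_simps)
next
  case False
  then show ?thesis
    by (simp add: support_fun_def rhs_set_def radius_def)
qed

text \<open>The maximum over the two signs turns \<open>\<psi> * dev\<close> into an absolute value,
  and the radius term is the same for both.\<close>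

lemma h_fun_eq:
  assumes "\<forall>i\<in>I. abar i > 0"
  shows "h_fun A I abar x z $ i = max 0 (gap A (radius I abar) i (x, z))"
  by (auto simp: h_fun_def ell_fun_def support_fun_rhs_set[OF assms] gap_def dev_def abs_if
    algebra_simps)

lemma h_sq_eq:
  assumes "\<forall>i\<in>I. abar i > 0"
  shows "h_sq A I abar y = (\<Sum>i\<in>UNIV. (max 0 (gap A (radius I abar) i y))\<^sup>2)"
  by (simp add: h_sq_def h_fun_eq[OF assms] split: prod.split)

lemma dev_add_scaleR: "dev A i (y + \<alpha> *\<^sub>R d) = dev A i y + \<alpha> * dev A i d"
  by (simp add: dev_def inner_add_right algebra_simps split: prod.split)

text \<open>With these, the superdifferential at \<open>y\<close> is the box with centre \<open>(grad1, grad2)\<close> and half-widths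
  \<open>(spread, 0)\<close>.\<close>

definition weight :: "real^'n^'n \<Rightarrow> ('n \<Rightarrow> real) \<Rightarrow> (real^'n) \<times> (real^'n) \<Rightarrow> real" where
  "weight A b y = (\<Sum>i\<in>UNIV. 2 * max 0 (gap A b i y) * b i)"

definition grad2 :: "real^'n^'n \<Rightarrow> ('n \<Rightarrow> real) \<Rightarrow> (real^'n) \<times> (real^'n) \<Rightarrow> real^'n" where
  "grad2 A b y = (\<chi> i. 2 * max 0 (gap A b i y) * sgn (dev A i y))"

definition grad1 :: "real^'n^'n \<Rightarrow> ('n \<Rightarrow> real) \<Rightarrow> (real^'n) \<times> (real^'n) \<Rightarrow> real^'n" where
  "grad1 A b y = (\<chi> j. - (\<Sum>i\<in>UNIV. grad2 A b y $ i * A $ i $ j) - weight A b y * sgn (fst y $ j))"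

definition spread :: "real^'n^'n \<Rightarrow> ('n \<Rightarrow> real) \<Rightarrow> (real^'n) \<times> (real^'n) \<Rightarrow> real^'n" where
  "spread A b y = (\<chi> j. if fst y $ j = 0 then weight A b y else 0)"

section \<open>Directional derivatives of the integrand\<close>

lemma has_real_derivative_abs_at_right:
  "((\<lambda>\<alpha>. \<bar>a + \<alpha> * v\<bar>) has_real_derivative (if a = 0 then \<bar>v\<bar> else sgn a * v)) (at_right 0)"
proof (cases "a = 0")
  case True
  have "((\<lambda>\<alpha>. \<bar>\<alpha> * v\<bar> / \<alpha>) \<longlongrightarrow> \<bar>v\<bar>) (at_right 0)"
    using eventually_at_right_less[of 0]
    by (intro tendsto_eventually) (auto elim!: eventually_mono simp: abs_mult)
  then show ?thesis using True by (simp add: has_field_derivative_iff)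
next
  case False
  \<comment> \<open>Within distance \<open>\<bar>a\<bar>\<close> of \<open>a\<close> the sign does
    not change, so \<open>abs\<close> agrees there with this linear function.\<close>
  have "((\<lambda>t. sgn a * t) has_real_derivative sgn a) (at a)"
    by (auto intro!: derivative_eq_intros)
  then have *: "(abs has_real_derivative sgn a) (at a)"
    by (rule has_field_derivative_transform_within[where d="\<bar>a\<bar>"])
      (use False in \<open>auto simp: dist_real_def sgn_if\<close>)
  have "((\<lambda>\<alpha>. \<bar>a + \<alpha> * v\<bar>) has_real_derivative sgn a * v) (at 0)"
    by (rule DERIV_chain2[of abs _ "\<lambda>\<alpha>. a + \<alpha> * v"]) (use * in \<open>auto intro!: derivative_eq_intros\<close>)
  then show ?thesis using False by (simp add: has_field_derivative_at_within)
qed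

text \<open>Squaring removes the kink of the positive part: at 0 the difference quotient is bounded
  by \<open>\<bar>y\<bar>\<close>, and elsewhere the function agrees locally with 0 or with the
  square.\<close>

lemma has_real_derivative_pos_part_squared:
  "((\<lambda>t. (max 0 t)\<^sup>2) has_real_derivative 2 * max 0 t) (at t)" for t :: real
proof (cases t "0::real" rule: linorder_cases)
  case less
  have "((\<lambda>t. 0) has_real_derivative 0) (at t)" by simp
  then have "((\<lambda>t. (max 0 t)\<^sup>2) has_real_derivative 0) (at t)"
    by (rule has_field_derivative_transform_within[where d="-t"]) (use less in \<open>auto simp: dist_real_def\<close>)
  with less show ?thesis by simp
next
  case greater
  have "((\<lambda>t. t\<^sup>2) has_real_derivative 2 * t) (at t)" by (auto intro!: derivative_eq_intros)
  then have "((\<lambda>t. (max 0 t)\<^sup>2) has_real_derivative 2 * t) (at t)"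
    by (rule has_field_derivative_transform_within[where d="t"]) (use greater in \<open>auto simp: dist_real_def\<close>)
  with greater show ?thesis by simp
next
  case equal
  have "((\<lambda>y. (max 0 y)\<^sup>2 / y) \<longlongrightarrow> (0::real)) (at 0)"
    by (rule Lim_null_comparison[where g="\<lambda>y. \<bar>y\<bar>"])
      (auto intro!: always_eventually tendsto_eq_intros simp: max_def power2_eq_square)
  with equal show ?thesis by (simp add: has_field_derivative_iff)
qed

lemma has_real_derivative_norm1_at_right:
  "((\<lambda>\<alpha>. norm1 (x + \<alpha> *\<^sub>R d)) has_real_derivative
     (\<Sum>j\<in>UNIV. if x $ j = 0 then \<bar>d $ j\<bar> else sgn (x $ j) * d $ j)) (at_right 0)"
  unfolding norm1_def vector_add_component vector_scaleR_component real_scaleR_def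
  by (intro DERIV_sum has_real_derivative_abs_at_right)

lemma has_real_derivative_gap_at_right:
  "((\<lambda>\<alpha>. gap A b i (y + \<alpha> *\<^sub>R d)) has_real_derivative
     (if dev A i y = 0 then \<bar>dev A i d\<bar> else sgn (dev A i y) * dev A i d) -
     b i * (\<Sum>j\<in>UNIV. if fst y $ j = 0 then \<bar>fst d $ j\<bar> else sgn (fst y $ j) * fst d $ j)) (at_right 0)"
  unfolding gap_def dev_add_scaleR fst_add fst_scaleR
  by (intro DERIV_diff DERIV_cmult has_real_derivative_norm1_at_right has_real_derivative_abs_at_right)

text \<open>The kink of \<open>\<bar>dev\<bar>\<close> does no harm to h^2: where \<open>dev\<close>
  vanishes the gap is at most 0, so the factor \<open>2 * max 0 gap\<close> from the chain rule
  cancels it.\<close>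

lemma gap_nonpos: "\<lbrakk>dev A i y = 0; \<And>i. 0 \<le> b i\<rbrakk> \<Longrightarrow> max 0 (gap A b i y) = 0"
  using mult_nonneg_nonneg[OF _ norm1_nonneg, of "b i" "fst y"] by (simp add: gap_def)

text \<open>For nonnegative \<open>b\<close> this is the minimum of \<open>w \<bullet> d\<close>
  over the box, attained by moving each coordinate from the centre against the sign of
  \<open>fst d\<close>.\<close>

definition dir_deriv :: "real^'n^'n \<Rightarrow> ('n \<Rightarrow> real) \<Rightarrow> (real^'n) \<times> (real^'n) \<Rightarrow> (real^'n) \<times> (real^'n) \<Rightarrow> real" where
  "dir_deriv A b y d = grad1 A b y \<bullet> fst d + grad2 A b y \<bullet> snd d -
     (\<Sum>j\<in>UNIV. spread A b y $ j * \<bar>fst d $ j\<bar>)"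

text \<open>Passes from the chain rule, a sum over rows \<open>i\<close>, to the coefficients of the
  box, a sum over coordinates \<open>j\<close>.\<close>

lemma dir_deriv_eq:
  "dir_deriv A b y d = (\<Sum>i\<in>UNIV. 2 * max 0 (gap A b i y) * (sgn (dev A i y) * dev A i d -
     b i * (\<Sum>j\<in>UNIV. if fst y $ j = 0 then \<bar>fst d $ j\<bar> else sgn (fst y $ j) * fst d $ j)))"
proof -
  let ?S = "\<Sum>j\<in>UNIV. if fst y $ j = 0 then \<bar>fst d $ j\<bar> else sgn (fst y $ j) * fst d $ j"
  have "(\<Sum>i\<in>UNIV. 2 * max 0 (gap A b i y) * (sgn (dev A i y) * dev A i d - b i * ?S)) =
      (\<Sum>i\<in>UNIV. grad2 A b y $ i * dev A i d) - weight A b y * ?S"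
    by (simp add: right_diff_distrib sum_subtractf sum_distrib_right weight_def grad2_def mult.assoc)
  also have "(\<Sum>i\<in>UNIV. grad2 A b y $ i * dev A i d) =
      grad2 A b y \<bullet> snd d - (\<Sum>i\<in>UNIV. \<Sum>j\<in>UNIV. grad2 A b y $ i * A $ i $ j * fst d $ j)"
    by (simp add: dev_def inner_vec_def row_def right_diff_distrib sum_subtractf sum_distrib_left
        mult.assoc split_beta)
  also have "(\<Sum>i\<in>UNIV. \<Sum>j\<in>UNIV. grad2 A b y $ i * A $ i $ j * fst d $ j) =
      (\<Sum>j\<in>UNIV. (\<Sum>i\<in>UNIV. grad2 A b y $ i * A $ i $ j) * fst d $ j)"
    by (subst sum.swap) (simp add: sum_distrib_right)
  \<comment> \<open>Since sgn 0 = 0, the vanishing coordinates enter only the \<open>spread\<close>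
    sum and the others only the \<open>sgn\<close> sum.\<close>
  also have "weight A b y * ?S = (\<Sum>j\<in>UNIV. weight A b y * sgn (fst y $ j) * fst d $ j) +
      (\<Sum>j\<in>UNIV. spread A b y $ j * \<bar>fst d $ j\<bar>)"
    unfolding sum_distrib_left sum.distrib[symmetric] by (intro sum.cong) (auto simp: spread_def)
  finally show ?thesis
    by (simp add: dir_deriv_def inner_vec_def grad1_def left_diff_distrib sum_subtractf sum_negf)
qed

lemma h_sq_dir_deriv:
  assumes abar: "\<forall>i\<in>I. abar i > 0"
  defines "b \<equiv> radius I abar"
  shows "((\<lambda>\<alpha>. (h_sq A I abar (y + \<alpha> *\<^sub>R d) - h_sq A I abar y) / \<alpha>) \<longlongrightarrow> dir_deriv A b y d) (at_right 0)"
proof -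
  have b: "0 \<le> b i" for i using abar by (auto simp: b_def radius_def less_imp_le)
  let ?S = "\<Sum>j\<in>UNIV. if fst y $ j = 0 then \<bar>fst d $ j\<bar> else sgn (fst y $ j) * fst d $ j"
  have "((\<lambda>\<alpha>. h_sq A I abar (y + \<alpha> *\<^sub>R d)) has_real_derivative dir_deriv A b y d) (at_right 0)"
    unfolding h_sq_eq[OF abar] b_def[symmetric] dir_deriv_eq
  proof (intro DERIV_sum)
    fix i
    let ?G = "(if dev A i y = 0 then \<bar>dev A i d\<bar> else sgn (dev A i y) * dev A i d) - b i * ?S"
    have "((\<lambda>\<alpha>. (max 0 (gap A b i (y + \<alpha> *\<^sub>R d)))\<^sup>2) has_real_derivative
        2 * max 0 (gap A b i (y + 0 *\<^sub>R d)) * ?G) (at_right 0)"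
      by (rule DERIV_chain2[OF has_real_derivative_pos_part_squared has_real_derivative_gap_at_right])
    \<comment> \<open>If \<open>dev A i y = 0\<close>, both sides are 0 by
      \<open>gap_nonpos\<close>; otherwise \<open>?G\<close> already has the required form.\<close>
    also have "2 * max 0 (gap A b i (y + 0 *\<^sub>R d)) * ?G =
        2 * max 0 (gap A b i y) * (sgn (dev A i y) * dev A i d - b i * ?S)"
      using gap_nonpos[of A i y b] b by auto
    finally show "((\<lambda>\<alpha>. (max 0 (gap A b i (y + \<alpha> *\<^sub>R d)))\<^sup>2) has_real_derivative
        2 * max 0 (gap A b i y) * (sgn (dev A i y) * dev A i d - b i * ?S)) (at_right 0)" .
  qed
  then show ?thesis by (simp add: has_field_derivative_iff)
qed

lemma weight_nonneg: "(\<And>i. 0 \<le> b i) \<Longrightarrow> 0 \<le> weight A b y"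
  by (auto simp: weight_def intro!: sum_nonneg)

lemma spread_nonneg: "(\<And>i. 0 \<le> b i) \<Longrightarrow> 0 \<le> spread A b y $ j"
  by (simp add: spread_def weight_nonneg)

text \<open>The value \<open>sgn 0 = 0\<close> makes \<^const>\<open>grad1\<close> the centre of the superdifferential also where
  coordinates of \<open>x\<close> vanish.\<close>

lemma superdifferential_h_sq:
  fixes A :: "real^'n^'n"
  assumes abar: "\<forall>i\<in>I. abar i > 0"
  defines "b \<equiv> radius I abar"
  shows "superdifferential (h_sq A I abar) y =
    {(w1, w2). (\<forall>j. \<bar>w1 $ j - grad1 A b y $ j\<bar> \<le> spread A b y $ j) \<and> w2 = grad2 A b y}"
proof (rule superdifferential_eqI)
  let ?D = "{(w1, w2). (\<forall>j. \<bar>w1 $ j - grad1 A b y $ j\<bar> \<le> spread A b y $ j) \<and> w2 = grad2 A b y}"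
  have b: "0 \<le> b i" for i using abar by (auto simp: b_def radius_def less_imp_le)
  note spr = spread_nonneg[of b A y, OF b]
  have D: "?D = cbox (grad1 A b y - spread A b y) (grad1 A b y + spread A b y) \<times> {grad2 A b y}"
    by (force simp: cbox_interval less_eq_vec_def abs_le_iff mem_box_cart algebra_simps)
  show "is_superdifferential (h_sq A I abar) y ?D"
    unfolding is_superdifferential_def
  proof (intro conjI allI)
    show "convex ?D" "compact ?D"
      unfolding D by (intro convex_Times compact_Times convex_box compact_cbox; simp)+
    fix d :: "(real^'n) \<times> (real^'n)"
    \<comment> \<open>Going to the end of each interval opposite in sign to \<open>fst d\<close>
      minimises the inner product coordinatewise.\<close>
    define w where "w = (grad1 A b y - (\<chi> j. spread A b y $ j * sgn (fst d $ j)), grad2 A b y)"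
    have w: "w \<in> ?D"
      using spr by (auto simp: w_def abs_mult sgn_if)
    have wd: "w \<bullet> d = dir_deriv A b y d"
      by (simp add: w_def inner_prod_def dir_deriv_def inner_diff_left inner_vec_def abs_sgn
        algebra_simps sum_subtractf)
    have "w \<bullet> d \<le> v \<bullet> d" if "v \<in> ?D" for v
    proof -
      have v: "snd v = grad2 A b y"
        and v1: "\<And>j. \<bar>fst v $ j - grad1 A b y $ j\<bar> \<le> spread A b y $ j"
        using that by (auto simp: split_beta)
      have "\<bar>(fst v - grad1 A b y) \<bullet> fst d\<bar> \<le> (\<Sum>j\<in>UNIV. spread A b y $ j * \<bar>fst d $ j\<bar>)"
        unfolding inner_vec_def using v1
        by (intro order_trans[OF sum_abs] sum_mono) (auto simp: abs_mult intro!: mult_right_mono)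
      then show ?thesis
        unfolding wd dir_deriv_def by (simp add: v inner_prod_def inner_diff_left)
    qed
    then show "\<exists>w. is_arg_min (\<lambda>v. v \<bullet> d) (\<lambda>v. v \<in> ?D) w \<and>
       ((\<lambda>\<alpha>. (h_sq A I abar (y + \<alpha> *\<^sub>R d) - h_sq A I abar y) / \<alpha>) \<longlongrightarrow> w \<bullet> d) (at_right 0)"
      using w h_sq_dir_deriv[OF abar, of A y d] unfolding b_def[symmetric] wd[symmetric]
      by (auto simp: is_arg_min_linorder)
  qed
qed

section \<open>Lipschitz and growth bounds\<close>

text \<open>\<open>gap\<close> is built from linear maps, an absolute value and
  \<open>norm1\<close>, all Lipschitz, and taking positive parts does not increase distances. With
  \<open>z = 0\<close>, where the gap vanishes, the bound becomes linear growth of the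
  excess.\<close>

lemma excess_lipschitz:
  fixes A :: "real^'n^'n"
  assumes b: "\<And>i. 0 \<le> b i"
  obtains K where "0 \<le> K"
    "\<And>i y z. \<bar>max 0 (gap A b i y) - max 0 (gap A b i z)\<bar> \<le> K * norm (y - z)"
proof
  \<comment> \<open>The three summands bound the variation of \<open>z $ i\<close>, of
    \<open>row i A \<bullet> x\<close> and of \<open>b i * norm1 x\<close>; summing over the rows
    makes the constant independent of \<open>i\<close>.\<close>
  define k where "k i = 1 + norm (row i A) + b i * real CARD('n)" for i
  have k: "0 \<le> k i" for i using b by (simp add: k_def)
  show "0 \<le> sum k UNIV" by (simp add: sum_nonneg k)
  fix i and y z :: "(real^'n) \<times> (real^'n)"
  have "\<bar>dev A i y - dev A i z\<bar> \<le> norm (snd (y - z)) + norm (row i A) * norm (fst (y - z))"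
  proof -
    have "dev A i y - dev A i z = snd (y - z) $ i - row i A \<bullet> fst (y - z)"
      by (simp add: dev_def split_beta inner_diff_right)
    then show ?thesis
      using component_le_norm_cart[of "snd (y - z)" i] Cauchy_Schwarz_ineq2[of "row i A" "fst (y - z)"]
      by linarith
  qed
  also have "\<dots> \<le> norm (y - z) + norm (row i A) * norm (y - z)"
    by (intro add_mono mult_left_mono) (metis norm_snd_le prod.collapse, metis norm_fst_le prod.collapse, simp)
  finally have 1: "\<bar>dev A i y - dev A i z\<bar> \<le> norm (y - z) + norm (row i A) * norm (y - z)" .
  have "\<bar>norm1 (fst y) - norm1 (fst z)\<bar> \<le> (\<Sum>j\<in>UNIV. \<bar>fst y $ j - fst z $ j\<bar>)"
    unfolding norm1_def sum_subtractf[symmetric]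
    by (intro order_trans[OF sum_abs] sum_mono abs_triangle_ineq3)
  also have "\<dots> \<le> (\<Sum>j\<in>(UNIV::'n set). norm (y - z))"
  proof (intro sum_mono)
    fix j
    show "\<bar>fst y $ j - fst z $ j\<bar> \<le> norm (y - z)"
      using component_le_norm_cart[of "fst (y - z)" j] norm_fst_le[of "fst (y - z)" "snd (y - z)"]
      unfolding prod.collapse by simp
  qed
  finally have 2: "\<bar>norm1 (fst y) - norm1 (fst z)\<bar> \<le> real CARD('n) * norm (y - z)" by simp
  have "\<bar>b i * norm1 (fst y) - b i * norm1 (fst z)\<bar> \<le> b i * (real CARD('n) * norm (y - z))"
    using mult_left_mono[OF 2 b[of i]] b[of i] by (simp add: right_diff_distrib[symmetric] abs_mult)
  then have "\<bar>gap A b i y - gap A b i z\<bar> \<le> k i * norm (y - z)"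
    using 1 unfolding gap_def k_def by (simp add: algebra_simps)
  also have "\<dots> \<le> sum k UNIV * norm (y - z)"
    by (intro mult_right_mono member_le_sum) (auto simp: k)
  finally show "\<bar>max 0 (gap A b i y) - max 0 (gap A b i z)\<bar> \<le> sum k UNIV * norm (y - z)"
    by linarith
qed

text \<open>Supplies a constant dominating the difference quotients uniformly over a ball. A
  difference of squares factors as (p - q) * (p + q): the first factor is of order \<alpha> by the
  Lipschitz bound, the second stays bounded as \<alpha> \<le> 1.\<close>

lemma h_sq_increment_bound:
  fixes A :: "real^'n^'n"
  assumes abar: "\<forall>i\<in>I. abar i > 0"
  obtains C where "\<And>y d \<alpha>. norm y \<le> R \<Longrightarrow> norm d \<le> R \<Longrightarrow> 0 < \<alpha> \<Longrightarrow> \<alpha> \<le> 1 \<Longrightarrow>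
    \<bar>h_sq A I abar (y + \<alpha> *\<^sub>R d) - h_sq A I abar y\<bar> \<le> C * \<alpha>"
proof -
  let ?b = "radius I abar"
  have b: "0 \<le> ?b i" for i using abar by (auto simp: radius_def less_imp_le)
  obtain K where K: "0 \<le> K"
    "\<And>i y z. \<bar>max 0 (gap A ?b i y) - max 0 (gap A ?b i z)\<bar> \<le> K * norm (y - z)"
    by (rule excess_lipschitz[where A = A and b = ?b, OF b]) blast
  have K0: "max 0 (gap A ?b i y) \<le> K * norm y" for i y
    using K(2)[of i y 0] by (simp add: gap_def dev_def norm1_def split_beta)
  show ?thesis
  proof (rule that)
    fix y d :: "(real^'n) \<times> (real^'n)" and \<alpha> :: real
    assume y: "norm y \<le> R" and d: "norm d \<le> R" and \<alpha>: "0 < \<alpha>" "\<alpha> \<le> 1"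
    have R: "0 \<le> R" using y norm_ge_zero order_trans by blast
    have yd: "norm (y + \<alpha> *\<^sub>R d) \<le> R + 1 * R"
      using y mult_mono[of \<alpha> 1 "norm d" R] d \<alpha> by (intro norm_triangle_le add_mono) auto
    have "\<bar>(max 0 (gap A ?b i (y + \<alpha> *\<^sub>R d)))\<^sup>2 - (max 0 (gap A ?b i y))\<^sup>2\<bar> \<le> (K * (\<alpha> * R)) * (K * (2 * R) + K * R)"
      (is "\<bar>?p\<^sup>2 - ?q\<^sup>2\<bar> \<le> _") for i
    proof -
      have "\<bar>?p\<^sup>2 - ?q\<^sup>2\<bar> = \<bar>?p - ?q\<bar> * (?p + ?q)"
        by (simp add: power2_eq_square square_diff_square_factored abs_mult)
      also have "\<dots> \<le> (K * (\<alpha> * R)) * (K * (2 * R) + K * R)"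
      proof (intro mult_mono add_mono)
        have "\<bar>?p - ?q\<bar> \<le> K * norm (\<alpha> *\<^sub>R d)" using K(2)[of i "y + \<alpha> *\<^sub>R d" y] by simp
        also have "\<dots> \<le> K * (\<alpha> * R)" using K(1) d \<alpha> by (auto intro!: mult_left_mono)
        finally show "\<bar>?p - ?q\<bar> \<le> K * (\<alpha> * R)" .
        show "?p \<le> K * (2 * R)" using yd K(1) by (intro order_trans[OF K0] mult_left_mono) auto
        show "?q \<le> K * R" using y K(1) by (intro order_trans[OF K0] mult_left_mono) auto
      qed (use K(1) R \<alpha> in auto)
      finally show ?thesis .
    qed
    then have "\<bar>h_sq A I abar (y + \<alpha> *\<^sub>R d) - h_sq A I abar y\<bar> \<le>
        (\<Sum>i\<in>(UNIV::'n set). (K * (\<alpha> * R)) * (K * (2 * R) + K * R))"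
      unfolding h_sq_eq[OF abar] sum_subtractf[symmetric]
      by (intro order_trans[OF sum_abs] sum_mono)
    then show "\<bar>h_sq A I abar (y + \<alpha> *\<^sub>R d) - h_sq A I abar y\<bar> \<le>
        (real CARD('n) * K * R * (K * (2 * R) + K * R)) * \<alpha>"
      by (simp add: mult_ac)
  qed
qed

text \<open>All three coefficients are sums of excesses with factors that are constants or signs, so
  they inherit linear growth; along a bounded trajectory they are therefore bounded.\<close>

lemma superdifferential_coeffs_linear_growth:
  fixes A :: "real^'n^'n"
  assumes b: "\<And>i. 0 \<le> b i"
  obtains C where "0 \<le> C" "\<And>y j. \<bar>grad1 A b y $ j\<bar> \<le> C * norm y"
    "\<And>y j. \<bar>grad2 A b y $ j\<bar> \<le> C * norm y" "\<And>y j. \<bar>spread A b y $ j\<bar> \<le> C * norm y"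
proof -
  obtain K where K: "0 \<le> K"
    "\<And>i y z. \<bar>max 0 (gap A b i y) - max 0 (gap A b i z)\<bar> \<le> K * norm (y - z)"
    by (rule excess_lipschitz[where A = A and b = b, OF b]) blast
  have K0: "max 0 (gap A b i y) \<le> K * norm y" for i y
    using K(2)[of i y 0] by (simp add: gap_def dev_def norm1_def split_beta)
  have g2: "\<bar>grad2 A b y $ i\<bar> \<le> 2 * K * norm y" for y i
    using K0[of i y] by (auto simp: grad2_def abs_mult sgn_if K(1))
  define Ca where "Ca = (\<Sum>i\<in>UNIV. 2 * K * b i)"
  have Ca: "0 \<le> Ca" using K b by (auto simp: Ca_def intro!: sum_nonneg)
  have w: "\<bar>weight A b y\<bar> \<le> Ca * norm y" for y
  proof -
    have "weight A b y \<le> (\<Sum>i\<in>UNIV. 2 * (K * norm y) * b i)"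
      unfolding weight_def using K0 b by (intro sum_mono mult_right_mono mult_left_mono) auto
    then show ?thesis
      using weight_nonneg[of b A y, OF b] by (simp add: Ca_def sum_distrib_left sum_distrib_right mult_ac)
  qed
  \<comment> \<open>Summing over the columns as well makes the bound independent of
    \<open>j\<close>.\<close>
  define Cb where "Cb = (\<Sum>j\<in>UNIV. \<Sum>i\<in>UNIV. 2 * K * \<bar>A $ i $ j\<bar>)"
  have Cb: "0 \<le> Cb" using K by (auto simp: Cb_def intro!: sum_nonneg)
  have lin: "\<bar>\<Sum>i\<in>UNIV. grad2 A b y $ i * A $ i $ j\<bar> \<le> Cb * norm y" for y j
  proof -
    have "\<bar>\<Sum>i\<in>UNIV. grad2 A b y $ i * A $ i $ j\<bar> \<le> (\<Sum>i\<in>UNIV. 2 * K * norm y * \<bar>A $ i $ j\<bar>)"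
      by (intro order_trans[OF sum_abs] sum_mono) (simp add: abs_mult mult_right_mono g2)
    also have "\<dots> = (\<Sum>i\<in>UNIV. 2 * K * \<bar>A $ i $ j\<bar>) * norm y"
      unfolding sum_distrib_right by (intro sum.cong) (simp_all add: mult_ac)
    also have "\<dots> \<le> Cb * norm y"
      unfolding Cb_def using K
      by (intro mult_right_mono member_le_sum[of j UNIV "\<lambda>j. \<Sum>i\<in>UNIV. 2 * K * \<bar>A $ i $ j\<bar>"])
        (auto intro!: sum_nonneg)
    finally show ?thesis .
  qed
  show ?thesis
  proof (rule that[of "2 * K + Ca + Cb"])
    show "0 \<le> 2 * K + Ca + Cb" using K Ca Cb by simp
    fix y :: "(real^'n) \<times> (real^'n)" and j
    have nn: "0 \<le> K * norm y" "0 \<le> Ca * norm y" "0 \<le> Cb * norm y" using K Ca Cb by auto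
    have "\<bar>weight A b y * sgn (fst y $ j)\<bar> \<le> \<bar>weight A b y\<bar>"
      by (simp add: abs_mult sgn_if)
    then show "\<bar>grad1 A b y $ j\<bar> \<le> (2 * K + Ca + Cb) * norm y"
      using w[of y] lin[of y j] nn unfolding grad1_def distrib_right vec_lambda_beta by linarith
    show "\<bar>grad2 A b y $ j\<bar> \<le> (2 * K + Ca + Cb) * norm y"
      using g2[of y j] nn unfolding distrib_right by linarith
    show "\<bar>spread A b y $ j\<bar> \<le> (2 * K + Ca + Cb) * norm y"
      using w[of y] nn unfolding distrib_right by (simp add: spread_def)
  qed
qed

section \<open>Borel measurability of the integrand and its coefficients\<close>

lemma borel_measurable_vecI:
  fixes f :: "'a \<Rightarrow> real^'n"
  assumes "\<And>j. (\<lambda>t. f t $ j) \<in> borel_measurable M"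
  shows "f \<in> borel_measurable M"
  by (subst borel_measurable_euclidean_space) (use assms in \<open>auto simp: Basis_vec_def inner_axis\<close>)

lemma borel_measurable_vec_nth [measurable]: "(\<lambda>x. x $ j) \<in> borel_measurable borel"
  for j :: "'n::finite"
  by (intro borel_measurable_continuous_onI continuous_intros)

lemma borel_measurable_gap [measurable]: "gap A b i \<in> borel_measurable borel"
  unfolding gap_def dev_def norm1_def split_beta
  by (intro borel_measurable_continuous_onI continuous_intros)

lemma borel_measurable_dev [measurable]: "dev A i \<in> borel_measurable borel"
  unfolding dev_def split_beta by (intro borel_measurable_continuous_onI continuous_intros)

lemma borel_measurable_fst_nth [measurable]: "(\<lambda>y. fst y $ j) \<in> borel_measurable borel"
  for j :: "'n::finite"
  by (intro borel_measurable_continuous_onI continuous_intros)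

lemma borel_measurable_weight [measurable]: "weight A b \<in> borel_measurable borel"
  unfolding weight_def by measurable

lemma borel_measurable_grad2 [measurable]: "grad2 A b \<in> borel_measurable borel"
  by (rule borel_measurable_vecI) (simp add: grad2_def)

lemma borel_measurable_grad1 [measurable]: "grad1 A b \<in> borel_measurable borel"
  by (rule borel_measurable_vecI) (simp add: grad1_def)

lemma borel_measurable_spread [measurable]: "spread A b \<in> borel_measurable borel"
  by (rule borel_measurable_vecI) (simp add: spread_def)

lemma borel_measurable_h_sq:
  assumes "\<forall>i\<in>I. abar i > 0"
  shows "h_sq A I abar \<in> borel_measurable borel"
  unfolding h_sq_eq[OF assms, abs_def] by measurable

section \<open>Trajectories and functionals on them\<close>

lemma traj_deriv_eqI:
  assumes "(g has_vector_derivative d) (if t < T then at_right t else at_left t)"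
  shows "traj_deriv T g t = d"
  using assms unfolding traj_deriv_def
  by (cases "t < T") (auto intro!: vector_derivative_within)

lemma trajectories_has_vector_derivative:
  assumes "g \<in> trajectories T" "t \<in> {0..T}"
  shows "(g has_vector_derivative traj_deriv T g t) (if t < T then at_right t else at_left t)"
proof (cases "t < T")
  case True
  then show ?thesis
    using assms by (simp add: trajectories_def traj_deriv_def vector_derivative_works[symmetric])
next
  case False
  then have "t = T" using assms by simp
  then show ?thesis
    using assms by (simp add: trajectories_def traj_deriv_def vector_derivative_works[symmetric])
qed

lemma traj_deriv_add:
  assumes "f \<in> trajectories T" "g \<in> trajectories T" "t \<in> {0..T}"
  shows "traj_deriv T (\<lambda>t. f t + g t) t = traj_deriv T f t + traj_deriv T g t"
  using assms by (intro traj_deriv_eqI has_vector_derivative_add trajectories_has_vector_derivative)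

lemma traj_deriv_scaleR:
  assumes "g \<in> trajectories T" "t \<in> {0..T}"
  shows "traj_deriv T (\<lambda>t. c *\<^sub>R g t) t = c *\<^sub>R traj_deriv T g t"
proof (rule traj_deriv_eqI)
  show "((\<lambda>t. c *\<^sub>R g t) has_vector_derivative c *\<^sub>R traj_deriv T g t)
      (if t < T then at_right t else at_left t)"
    using bounded_linear.has_vector_derivative[OF bounded_linear_scaleR_right
        trajectories_has_vector_derivative[OF assms]] .
qed

text \<open>The sum and scaling rules for \<open>traj_deriv\<close> hold only on [0,T], so
  membership has to be transferred along equality there.\<close>

lemma pw_continuous_bounded_cong:
  "(\<And>t. t \<in> {0..T} \<Longrightarrow> f t = g t) \<Longrightarrow> f \<in> pw_continuous_bounded T \<longleftrightarrow> g \<in> pw_continuous_bounded T"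
proof -
  assume eq: "\<And>t. t \<in> {0..T} \<Longrightarrow> f t = g t"
  have "f ` {0..T} = g ` {0..T}"
    using eq by (rule image_cong[OF refl])
  moreover have "continuous_on ({0..T} - S) f \<longleftrightarrow> continuous_on ({0..T} - S) g" for S
    using eq by (intro continuous_on_cong) auto
  ultimately show ?thesis
    unfolding pw_continuous_bounded_def by simp
qed

lemma pw_continuous_bounded_add:
  assumes "f \<in> pw_continuous_bounded T" "g \<in> pw_continuous_bounded T"
  shows "(\<lambda>t. f t + g t) \<in> pw_continuous_bounded T"
proof -
  obtain S S' where S: "finite S" "continuous_on ({0..T} - S) f" "finite S'" "continuous_on ({0..T} - S') g"
    using assms by (auto simp: pw_continuous_bounded_def)
  have "continuous_on ({0..T} - (S \<union> S')) (\<lambda>t. f t + g t)"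
    by (intro continuous_on_add; rule continuous_on_subset) (use S in auto)
  moreover have "bounded ((\<lambda>t. f t + g t) ` {0..T})"
    using assms by (intro bounded_plus_comp) (auto simp: pw_continuous_bounded_def)
  ultimately show ?thesis
    using S(1,3) unfolding pw_continuous_bounded_def by blast
qed

lemma pw_continuous_bounded_scaleR:
  assumes "f \<in> pw_continuous_bounded T"
  shows "(\<lambda>t. c *\<^sub>R f t) \<in> pw_continuous_bounded T"
  using assms unfolding pw_continuous_bounded_def
  by (auto intro: bounded_scaleR_comp continuous_on_scaleR[OF continuous_on_const])

lemma trajectories_add:
  assumes T: "0 \<le> T" and f: "f \<in> trajectories T" and g: "g \<in> trajectories T"
  shows "(\<lambda>t. f t + g t) \<in> trajectories T"
proof -
  have "traj_deriv T (\<lambda>t. f t + g t) \<in> pw_continuous_bounded T"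
    using f g pw_continuous_bounded_add[of "traj_deriv T f" T "traj_deriv T g"]
    by (subst pw_continuous_bounded_cong[OF traj_deriv_add]) (auto simp: trajectories_def)
  then show ?thesis
    using f g by (auto simp: trajectories_def intro!: piecewise_C1_differentiable_add)
qed

lemma trajectories_scaleR:
  assumes T: "0 \<le> T" and g: "g \<in> trajectories T"
  shows "(\<lambda>t. c *\<^sub>R g t) \<in> trajectories T"
proof -
  have "traj_deriv T (\<lambda>t. c *\<^sub>R g t) \<in> pw_continuous_bounded T"
    using g pw_continuous_bounded_scaleR[of "traj_deriv T g" T c]
    by (subst pw_continuous_bounded_cong[OF traj_deriv_scaleR]) (auto simp: trajectories_def)
  then show ?thesis
    using g by (auto simp: trajectories_def intro!: piecewise_C1_differentiable_scaleR)
qed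

section \<open>Measurability and boundedness of trajectories\<close>

text \<open>Off the finite exceptional set the function is continuous on a measurable set, and
  changing finitely many values preserves measurability.\<close>

lemma pw_continuous_bounded_measurable:
  fixes f :: "real \<Rightarrow> 'b::euclidean_space"
  assumes "f \<in> pw_continuous_bounded T"
  shows "f \<in> borel_measurable (lebesgue_on {0..T})"
proof -
  obtain S where S: "finite S" "continuous_on ({0..T} - S) f"
    using assms by (auto simp: pw_continuous_bounded_def)
  have sets: "{0..T} - S \<in> sets lebesgue"
    using S(1) by (intro sets.Diff) (auto intro!: negligible_imp_sets negligible_finite)
  have "f \<in> borel_measurable (lebesgue_on ({0..T} - S))"
    by (intro continuous_imp_measurable_on_sets_lebesgue S(2) sets)
  then have "(\<lambda>t. if t \<in> {0..T} - S then f t else 0) \<in> borel_measurable (lebesgue_on {0..T})"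
    by (subst borel_measurable_if_lebesgue_on) (use sets in auto)
  then show ?thesis
  proof (rule measurable_discrete_difference)
    show "countable (S \<inter> {0..T})"
      using S(1) by (simp add: countable_finite)
    show "{t} \<in> sets (lebesgue_on {0..T})" if "t \<in> S \<inter> {0..T}" for t
      using that by (auto simp: sets_restrict_space image_iff intro!: bexI[of _ "{t}"])
  qed auto
qed

lemma trajectories_measurable:
  fixes g :: "real \<Rightarrow> 'b::euclidean_space"
  assumes "g \<in> trajectories T"
  shows "g \<in> borel_measurable (lebesgue_on {0..T})"
    "traj_deriv T g \<in> borel_measurable (lebesgue_on {0..T})"
proof -
  have "continuous_on {0..T} g"
    using assms by (simp add: trajectories_def piecewise_C1_differentiable_on_def)
  then show "g \<in> borel_measurable (lebesgue_on {0..T})"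
    by (rule continuous_imp_measurable_on_sets_lebesgue) simp
  show "traj_deriv T g \<in> borel_measurable (lebesgue_on {0..T})"
    using assms by (intro pw_continuous_bounded_measurable) (simp add: trajectories_def)
qed

lemma trajectories_bounded:
  fixes g :: "real \<Rightarrow> 'b::euclidean_space"
  assumes "g \<in> trajectories T"
  obtains R where "\<And>t. t \<in> {0..T} \<Longrightarrow> norm (g t) \<le> R"
    "\<And>t. t \<in> {0..T} \<Longrightarrow> norm (traj_deriv T g t) \<le> R"
    "\<And>t. t \<in> {0..T} \<Longrightarrow> norm (g t, traj_deriv T g t) \<le> R"
proof -
  have "continuous_on {0..T} g"
    using assms by (simp add: trajectories_def piecewise_C1_differentiable_on_def)
  then have "bounded (g ` {0..T})"
    by (intro compact_imp_bounded compact_continuous_image) auto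
  then obtain R1 where R1: "\<forall>v\<in>g ` {0..T}. norm v \<le> R1"
    unfolding bounded_iff by blast
  have "bounded (traj_deriv T g ` {0..T})"
    using assms by (simp add: trajectories_def pw_continuous_bounded_def)
  then obtain R2 where R2: "\<forall>v\<in>traj_deriv T g ` {0..T}. norm v \<le> R2"
    unfolding bounded_iff by blast
  show ?thesis
  proof (rule that[of "\<bar>R1\<bar> + \<bar>R2\<bar>"])
    fix t assume t: "t \<in> {0..T}"
    show "norm (g t) \<le> \<bar>R1\<bar> + \<bar>R2\<bar>" "norm (traj_deriv T g t) \<le> \<bar>R1\<bar> + \<bar>R2\<bar>"
      "norm (g t, traj_deriv T g t) \<le> \<bar>R1\<bar> + \<bar>R2\<bar>"
      using bspec[OF R1 imageI[OF t]] bspec[OF R2 imageI[OF t]]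
        norm_Pair_le[of "g t" "traj_deriv T g t"] by linarith+
  qed
qed

section \<open>Integral estimates\<close>

lemma finite_measure_lebesgue_on_Icc: "finite_measure (lebesgue_on {a..b::real})"
  by (rule finite_measure_lebesgue_on) auto

text \<open>Cauchy-Schwarz against the constant 1, obtained by expanding the integral of the square
  of \<open>?\<mu> * f t - ?a\<close>, which is nonnegative.\<close>

lemma (in finite_measure) square_integral_le:
  fixes f :: "'a \<Rightarrow> real"
  assumes f: "integrable M f" "integrable M (\<lambda>t. (f t)\<^sup>2)" and pos: "0 < measure M (space M)"
  shows "(\<integral>t. f t \<partial>M)\<^sup>2 \<le> measure M (space M) * (\<integral>t. (f t)\<^sup>2 \<partial>M)"
proof -
  let ?\<mu> = "measure M (space M)" and ?a = "\<integral>t. f t \<partial>M"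
  have "0 \<le> (\<integral>t. (?\<mu> * f t - ?a)\<^sup>2 \<partial>M)"
    by simp
  also have "(\<lambda>t. (?\<mu> * f t - ?a)\<^sup>2) = (\<lambda>t. (?\<mu>\<^sup>2 * (f t)\<^sup>2 - (2 * ?\<mu> * ?a) * f t) + ?a\<^sup>2)"
    by (auto simp: power2_eq_square algebra_simps)
  also have "(\<integral>t. (?\<mu>\<^sup>2 * (f t)\<^sup>2 - (2 * ?\<mu> * ?a) * f t) + ?a\<^sup>2 \<partial>M) =
      ?\<mu>\<^sup>2 * (\<integral>t. (f t)\<^sup>2 \<partial>M) - (2 * ?\<mu> * ?a) * ?a + ?a\<^sup>2 * ?\<mu>"
    using f by simp
  also have "\<dots> = ?\<mu> * (?\<mu> * (\<integral>t. (f t)\<^sup>2 \<partial>M) - ?a\<^sup>2)"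
    by (simp add: power2_eq_square algebra_simps)
  finally show ?thesis
    using pos by (simp add: zero_le_mult_iff)
qed

lemma integrable_inner_L_infinity:
  fixes w g :: "real \<Rightarrow> 'b::euclidean_space"
  assumes "w \<in> L_infinity T" and g: "g \<in> borel_measurable (lebesgue_on {0..T})"
    "\<And>t. t \<in> {0..T} \<Longrightarrow> norm (g t) \<le> R"
  shows "integrable (lebesgue_on {0..T}) (\<lambda>t. w t \<bullet> g t)"
proof -
  let ?M = "lebesgue_on {0..T}"
  interpret finite_measure ?M by (rule finite_measure_lebesgue_on_Icc)
  obtain C where w: "w \<in> borel_measurable ?M" and C: "AE t in ?M. norm (w t) \<le> C"
    using assms by (auto simp: L_infinity_def)
  show ?thesis
  proof (rule integrable_const_bound[where B="C * R"])
    show "AE t in ?M. norm (w t \<bullet> g t) \<le> C * R"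
      using C AE_space
    proof eventually_elim
      case (elim t)
      have "norm (w t \<bullet> g t) \<le> norm (w t) * norm (g t)"
        using Cauchy_Schwarz_ineq2 by simp
      also have "\<dots> \<le> C * R"
        using elim g(2)[of t] order_trans[OF norm_ge_zero elim(1)] by (intro mult_mono) auto
      finally show ?case .
    qed
    show "(\<lambda>t. w t \<bullet> g t) \<in> borel_measurable ?M"
      using w g(1) by measurable
  qed
qed

lemma integrable_trajectory_inner:
  fixes w g :: "real \<Rightarrow> 'b::euclidean_space"
  assumes "w \<in> L_infinity T" "g \<in> trajectories T"
  shows "integrable (lebesgue_on {0..T}) (\<lambda>t. w t \<bullet> g t)"
    "integrable (lebesgue_on {0..T}) (\<lambda>t. w t \<bullet> traj_deriv T g t)"
  using trajectories_bounded[OF assms(2)] trajectories_measurable[OF assms(2)]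
  by (metis integrable_inner_L_infinity assms(1))+

text \<open>The essential bound of \<open>w\<close> is pulled out, and the remaining L1 norm of
  \<open>g\<close> is at most sqrt T times its L2 norm. This gives continuity of the functionals
  with respect to \<open>traj_norm\<close>.\<close>

lemma abs_integral_inner_le:
  fixes w g :: "real \<Rightarrow> 'b::euclidean_space"
  assumes T: "0 < T" and w: "w \<in> borel_measurable (lebesgue_on {0..T})"
      "AE t in lebesgue_on {0..T}. norm (w t) \<le> C"
    and g: "g \<in> borel_measurable (lebesgue_on {0..T})" "\<And>t. t \<in> {0..T} \<Longrightarrow> norm (g t) \<le> R"
  shows "\<bar>LINT t|lebesgue_on {0..T}. w t \<bullet> g t\<bar> \<le>
    \<bar>C\<bar> * sqrt T * sqrt (LINT t|lebesgue_on {0..T}. (norm (g t))\<^sup>2)"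
proof -
  let ?M = "lebesgue_on {0..T}"
  interpret finite_measure ?M by (rule finite_measure_lebesgue_on_Icc)
  have sp: "measure ?M (space ?M) = T"
    using T by (simp add: measure_restrict_space)
  note [measurable] = g(1)
  have "integrable ?M (\<lambda>t. norm (g t))"
    using g(2) by (auto intro!: integrable_const_bound[where B=R])
  moreover have "integrable ?M (\<lambda>t. (norm (g t))\<^sup>2)"
    using g(2) by (auto intro!: integrable_const_bound[where B="R\<^sup>2"] AE_I2 power_mono)
  ultimately have int: "integrable ?M (\<lambda>t. norm (g t))" "integrable ?M (\<lambda>t. (norm (g t))\<^sup>2)"
    by auto
  have "\<bar>LINT t|?M. w t \<bullet> g t\<bar> \<le> (LINT t|?M. \<bar>C\<bar> * norm (g t))"
  proof (rule order_trans[OF integral_abs_bound integral_mono_AE])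
    show "integrable ?M (\<lambda>t. \<bar>w t \<bullet> g t\<bar>)"
      using w g by (intro integrable_abs integrable_inner_L_infinity) (auto simp: L_infinity_def)
    show "AE t in ?M. \<bar>w t \<bullet> g t\<bar> \<le> \<bar>C\<bar> * norm (g t)"
      using w(2)
    proof eventually_elim
      case (elim t)
      have "\<bar>w t \<bullet> g t\<bar> \<le> norm (w t) * norm (g t)"
        by (rule Cauchy_Schwarz_ineq2)
      also have "\<dots> \<le> \<bar>C\<bar> * norm (g t)"
        using elim by (intro mult_right_mono) auto
      finally show ?case .
    qed
  qed (use int in auto)
  also have "(LINT t|?M. \<bar>C\<bar> * norm (g t)) = \<bar>C\<bar> * (LINT t|?M. norm (g t))"
    by simp
  also have "(LINT t|?M. norm (g t)) \<le> sqrt (T * (LINT t|?M. (norm (g t))\<^sup>2))"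
    using square_integral_le[OF int] T unfolding sp by (intro real_le_rsqrt)
  finally show ?thesis
    by (simp add: real_sqrt_mult mult_left_mono mult.assoc)
qed

section \<open>Functionals given by bounded densities\<close>

text \<open>The abstraction is restricted to trajectories so that the functional is
  \<open>extensional\<close>, as membership in \<open>traj_dual\<close> demands.\<close>

definition traj_functional ::
    "real \<Rightarrow> (real \<Rightarrow> 'b) \<Rightarrow> (real \<Rightarrow> 'b) \<Rightarrow> (real \<Rightarrow> 'b::euclidean_space) \<Rightarrow> real" where
  "traj_functional T w1 w2 = (\<lambda>g\<in>trajectories T.
     (LINT t|lebesgue_on {0..T}. w1 t \<bullet> g t) + (LINT t|lebesgue_on {0..T}. w2 t \<bullet> traj_deriv T g t))"

text \<open>Linearity comes from that of the pair (g, g'). For the bound, each integral is estimated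
  by the L2 norm of the function paired with its density, and \<open>traj_norm\<close> dominates
  both norms.\<close>

lemma traj_functional_in_traj_dual:
  fixes w1 w2 :: "real \<Rightarrow> 'b::euclidean_space"
  assumes T: "0 < T" and w1: "w1 \<in> L_infinity T" and w2: "w2 \<in> L_infinity T"
  shows "traj_functional T w1 w2 \<in> traj_dual T"
proof -
  let ?M = "lebesgue_on {0..T}"
  have T0: "0 \<le> T" using T by simp
  note int = integrable_trajectory_inner[OF w1] integrable_trajectory_inner[OF w2]
  have deriv_cong: "(LINT t|?M. w2 t \<bullet> traj_deriv T f t) = (LINT t|?M. w2 t \<bullet> D t)"
    if "\<And>t. t \<in> {0..T} \<Longrightarrow> traj_deriv T f t = D t" for f D
    by (rule Bochner_Integration.integral_cong) (auto simp: that)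
  have add: "traj_functional T w1 w2 (\<lambda>t. f t + g t) = traj_functional T w1 w2 f + traj_functional T w1 w2 g"
    if f: "f \<in> trajectories T" and g: "g \<in> trajectories T" for f g
  proof -
    have "(LINT t|?M. w2 t \<bullet> traj_deriv T (\<lambda>t. f t + g t) t) =
        (LINT t|?M. w2 t \<bullet> (traj_deriv T f t + traj_deriv T g t))"
      by (intro deriv_cong traj_deriv_add f g)
    then show ?thesis
      using that int[OF f] int[OF g] trajectories_add[OF T0 f g]
      by (simp add: traj_functional_def inner_add_right)
  qed
  have scale: "traj_functional T w1 w2 (\<lambda>t. c *\<^sub>R g t) = c * traj_functional T w1 w2 g"
    if g: "g \<in> trajectories T" for c g
  proof -
    have "(LINT t|?M. w2 t \<bullet> traj_deriv T (\<lambda>t. c *\<^sub>R g t) t) = (LINT t|?M. w2 t \<bullet> c *\<^sub>R traj_deriv T g t)"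
      by (intro deriv_cong traj_deriv_scaleR g)
    then show ?thesis
      using that int[OF g] trajectories_scaleR[OF T0 g]
      by (simp add: traj_functional_def distrib_left)
  qed
  obtain C1 where C1: "w1 \<in> borel_measurable ?M" "AE t in ?M. norm (w1 t) \<le> C1"
    using w1 by (auto simp: L_infinity_def)
  obtain C2 where C2: "w2 \<in> borel_measurable ?M" "AE t in ?M. norm (w2 t) \<le> C2"
    using w2 by (auto simp: L_infinity_def)
  have "\<bar>traj_functional T w1 w2 g\<bar> \<le> ((\<bar>C1\<bar> + \<bar>C2\<bar>) * sqrt T) * traj_norm T g"
    if g: "g \<in> trajectories T" for g
  proof -
    obtain R where R: "\<And>t. t \<in> {0..T} \<Longrightarrow> norm (g t) \<le> R"
      "\<And>t. t \<in> {0..T} \<Longrightarrow> norm (traj_deriv T g t) \<le> R"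
      using trajectories_bounded[OF g] by metis
    let ?a = "LINT t|?M. (norm (g t))\<^sup>2" and ?b = "LINT t|?M. (norm (traj_deriv T g t))\<^sup>2"
    have ab: "0 \<le> ?a" "0 \<le> ?b" by simp_all
    have "\<bar>traj_functional T w1 w2 g\<bar> \<le> \<bar>C1\<bar> * sqrt T * sqrt ?a + \<bar>C2\<bar> * sqrt T * sqrt ?b"
      using abs_integral_inner_le[OF T C1 trajectories_measurable(1)[OF g] R(1)]
        abs_integral_inner_le[OF T C2 trajectories_measurable(2)[OF g] R(2)] g
      by (simp add: traj_functional_def)
    also have "\<dots> \<le> \<bar>C1\<bar> * sqrt T * traj_norm T g + \<bar>C2\<bar> * sqrt T * traj_norm T g"
      unfolding traj_norm_def using T ab by (intro add_mono mult_left_mono) auto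
    finally show ?thesis by (simp add: algebra_simps)
  qed
  then show ?thesis
    using add scale unfolding traj_dual_def by (auto simp: traj_functional_def)
qed

text \<open>Allows a density \<open>w2\<close> that is determined only almost everywhere to be
  replaced by \<open>grad2\<close>.\<close>

lemma traj_functional_cong_AE:
  fixes w1 w2 :: "real \<Rightarrow> 'b::euclidean_space"
  assumes "w1 \<in> borel_measurable (lebesgue_on {0..T})" "v1 \<in> borel_measurable (lebesgue_on {0..T})"
    "w2 \<in> borel_measurable (lebesgue_on {0..T})" "v2 \<in> borel_measurable (lebesgue_on {0..T})"
    and eq: "AE t in lebesgue_on {0..T}. w1 t = v1 t" "AE t in lebesgue_on {0..T}. w2 t = v2 t"
  shows "traj_functional T w1 w2 = traj_functional T v1 v2"
proof
  fix g
  note [measurable] = assms(1-4)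
  show "traj_functional T w1 w2 g = traj_functional T v1 v2 g"
  proof (cases "g \<in> trajectories T")
    case True
    note [measurable] = trajectories_measurable[OF True]
    have "(LINT t|lebesgue_on {0..T}. w1 t \<bullet> g t) = (LINT t|lebesgue_on {0..T}. v1 t \<bullet> g t)"
      using eq(1) by (intro integral_cong_AE) (auto elim!: eventually_mono)
    moreover have "(LINT t|lebesgue_on {0..T}. w2 t \<bullet> traj_deriv T g t) =
        (LINT t|lebesgue_on {0..T}. v2 t \<bullet> traj_deriv T g t)"
      using eq(2) by (intro integral_cong_AE) (auto elim!: eventually_mono)
    ultimately show ?thesis by (simp add: traj_functional_def)
  qed (simp add: traj_functional_def)
qed

section \<open>Weak* compactness\<close>

text \<open>On indicators \<open>L\<close> is a signed set function bounded by the measure. Adding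
  the measure gives a nonnegative measure below twice the original one, whose Radon-Nikodym density
  \<open>D\<close> lies in [0,2] almost everywhere; the representing function is
  \<open>D - 1\<close>. Integrable functions are then reached from indicators by sums and
  limits.\<close>

lemma bounded_functional_on_L1_representation:
  fixes L :: "('a \<Rightarrow> real) \<Rightarrow> real"
  assumes M: "finite_measure M"
    and lin: "\<And>a f g. integrable M f \<Longrightarrow> integrable M g \<Longrightarrow>
      L (\<lambda>t. a * f t + g t) = a * L f + L g"
    and bnd: "\<And>f. integrable M f \<Longrightarrow> \<bar>L f\<bar> \<le> (\<integral>t. \<bar>f t\<bar> \<partial>M)"
  obtains s where "s \<in> borel_measurable M" "\<And>t. \<bar>s t\<bar> \<le> 1"
    "\<And>f. integrable M f \<Longrightarrow> L f = (\<integral>t. s t * f t \<partial>M)"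
proof -
  interpret finite_measure M by fact
  let ?ind = "\<lambda>B t. indicator B t :: real"
  have ind [simp]: "integrable M (?ind B)" if "B \<in> sets M" for B
    using that by (simp add: integrable_indicator_iff less_top[symmetric])
  define \<nu> where "\<nu> B = L (?ind B) + measure M B" for B
  have Lind: "\<bar>L (?ind B)\<bar> \<le> measure M B" if "B \<in> sets M" for B
    using bnd[of "?ind B"] that by simp
  have \<nu>: "0 \<le> \<nu> B" "\<nu> B \<le> 2 * measure M B" if "B \<in> sets M" for B
    using Lind[OF that] by (auto simp: \<nu>_def)
  have \<nu>_Un: "\<nu> (B \<union> C) = \<nu> B + \<nu> C" if "B \<in> sets M" "C \<in> sets M" "B \<inter> C = {}" for B C
  proof -
    have "?ind (B \<union> C) = (\<lambda>t. 1 * ?ind B t + ?ind C t)"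
      using that by (auto simp: indicator_def fun_eq_iff)
    then show ?thesis
      using that lin[of "?ind B" "?ind C" 1] by (simp add: \<nu>_def finite_measure_Union)
  qed
  define N where "N = measure_of (space M) (sets M) (\<lambda>B. ennreal (\<nu> B))"
  have sets_N [simp, measurable_cong]: "sets N = sets M" and space_N [simp]: "space N = space M"
    by (simp_all add: N_def)
  have \<nu>_empty: "\<nu> {} = 0"
    using \<nu>[of "{}"] by simp
  have pos: "positive (sets M) (\<lambda>B. ennreal (\<nu> B))"
    by (simp add: positive_def \<nu>_empty)
  \<comment> \<open>Finite additivity comes from \<open>\<nu>_Un\<close>; continuity at the empty
    set follows from the bound \<open>\<nu> B \<le> 2 * measure M B\<close>.\<close>
  have "countably_additive (sets M) (\<lambda>B. ennreal (\<nu> B))"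
  proof (rule sets.empty_continuous_imp_countably_additive[OF pos])
    show "additive (sets M) (\<lambda>B. ennreal (\<nu> B))"
      by (auto simp: additive_def \<nu>_Un \<nu>)
    fix B :: "nat \<Rightarrow> 'a set"
    assume B: "range B \<subseteq> sets M" "decseq B" "\<Inter> (range B) = {}"
    have "(\<lambda>i. 2 * measure M (B i)) \<longlonglongrightarrow> 2 * measure M (\<Inter> (range B))"
      by (intro tendsto_mult tendsto_const finite_Lim_measure_decseq B)
    then have "(\<lambda>i. \<nu> (B i)) \<longlonglongrightarrow> 0"
      using B by (intro tendsto_sandwich[of "\<lambda>_. 0" "\<lambda>i. \<nu> (B i)" _ "\<lambda>i. 2 * measure M (B i)"])
        (auto intro!: \<nu> always_eventually)
    then show "(\<lambda>i. ennreal (\<nu> (B i))) \<longlonglongrightarrow> 0"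
      using tendsto_ennrealI by fastforce
  qed auto
  then have em_N: "emeasure N B = ennreal (\<nu> B)" if "B \<in> sets M" for B
    unfolding N_def using that pos sets.sigma_algebra_axioms by (intro emeasure_measure_of_sigma)
  have fin_N: "finite_measure N"
    by (auto intro!: finite_measureI simp: em_N)
  have ac: "absolutely_continuous M N"
    using \<nu> by (force simp: absolutely_continuous_def null_sets_def em_N measure_def)
  obtain D where D [measurable]: "D \<in> borel_measurable M"
    and RN: "AE t in M. RN_deriv M N t = ennreal (D t)" and D_nn: "\<And>t. 0 \<le> D t"
    by (rule real_RN_deriv[OF fin_N ac sets_N]) blast
  have nn: "(\<integral>\<^sup>+t. ennreal (D t * ?ind B t) \<partial>M) = ennreal (\<nu> B)" if [measurable]: "B \<in> sets M" for B
  proof -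
    have "ennreal (\<nu> B) = (\<integral>\<^sup>+t. RN_deriv M N t * indicator B t \<partial>M)"
      using em_N[OF that] density_RN_deriv[OF ac sets_N] emeasure_density[of "RN_deriv M N" M B] by simp
    also have "\<dots> = (\<integral>\<^sup>+t. ennreal (D t * ?ind B t) \<partial>M)"
      using RN by (intro nn_integral_cong_AE) (auto elim!: eventually_mono simp: indicator_def)
    finally show ?thesis ..
  qed
  have int_D: "integrable M (\<lambda>t. D t * ?ind B t)" "(\<integral>t. D t * ?ind B t \<partial>M) = \<nu> B"
    if [measurable]: "B \<in> sets M" for B
    using integral_eq_nn_integral[of "\<lambda>t. D t * ?ind B t" M] nn[OF that] that
    by (auto intro!: integrableI_nonneg simp: D_nn \<nu>)
  \<comment> \<open>Over the set where \<open>D > 2\<close> the integral of \<open>D - 2\<close> is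
    \<nu> minus twice the measure, hence at most 0, while the integrand is nonnegative; so it
    vanishes almost everywhere.\<close>
  have "AE t in M. (D t - 2) * ?ind {t \<in> space M. D t > 2} t = 0"
  proof (subst integral_nonneg_eq_0_iff_AE[symmetric])
    let ?B = "{t \<in> space M. D t > 2}"
    have B: "?B \<in> sets M" by measurable
    have eq: "(\<lambda>t. (D t - 2) * ?ind ?B t) = (\<lambda>t. D t * ?ind ?B t - 2 * ?ind ?B t)"
      by (auto simp: algebra_simps)
    show "integrable M (\<lambda>t. (D t - 2) * ?ind ?B t)"
      unfolding eq using int_D(1)[OF B] ind[OF B] by (intro Bochner_Integration.integrable_diff) auto
    show nonneg: "AE t in M. 0 \<le> (D t - 2) * ?ind ?B t"
      by (auto simp: indicator_def)
    have "(\<integral>t. (D t - 2) * ?ind ?B t \<partial>M) = \<nu> ?B - 2 * measure M ?B"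
      unfolding eq using int_D[OF B] ind[OF B] B by (subst Bochner_Integration.integral_diff) auto
    then show "(\<integral>t. (D t - 2) * ?ind ?B t \<partial>M) = 0"
      using \<nu>[OF B] integral_nonneg_AE[OF nonneg] by simp
  qed
  then have D_le: "AE t in M. D t \<le> 2"
    using AE_space by eventually_elim (auto simp: indicator_def split: if_splits)
  \<comment> \<open>Truncation at 1 changes \<open>D - 1\<close> only on a null set and makes the
    bound hold at every point; the lower bound -1 comes from \<open>D \<ge> 0\<close>.\<close>
  define s where "s t = min 1 (D t - 1)" for t
  have s_D: "AE t in M. s t = D t - 1"
    using D_le by eventually_elim (auto simp: s_def)
  have s_meas [measurable]: "s \<in> borel_measurable M"
    unfolding s_def by measurable
  have s_le: "\<bar>s t\<bar> \<le> 1" for t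
    using D_nn[of t] by (auto simp: s_def)
  have int_s: "integrable M (\<lambda>t. s t * f t)" if "integrable M f" for f
    using that by (rule Bochner_Integration.integrable_bound)
      (use that s_le in \<open>auto simp: abs_mult intro!: mult_left_le_one_le borel_measurable_times\<close>)
  have "L f = (\<integral>t. s t * f t \<partial>M)" if "integrable M f" for f
    using that
  proof induction
    case (base B c)
    then have B: "B \<in> sets M" by simp
    \<comment> \<open>Homogeneity is drawn from \<open>lin\<close> by taking the indicator of the
      empty set, on which \<open>L\<close> is 0, as second summand.\<close>
    have "L (\<lambda>t. ?ind {} t) = 0"
      using Lind[of "{}"] by simp
    then have "L (\<lambda>t. c * ?ind B t) = c * L (?ind B)"
      using lin[of "?ind B" "?ind {}" c] B by simp
    moreover have "(\<integral>t. s t * ?ind B t \<partial>M) = L (?ind B)"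
    proof -
      have "(\<integral>t. s t * ?ind B t \<partial>M) = (\<integral>t. D t * ?ind B t - ?ind B t \<partial>M)"
        using s_D B by (intro integral_cong_AE) (auto simp: indicator_def elim!: eventually_mono)
      also have "\<dots> = L (?ind B)"
        using int_D[OF B] ind[OF B] B by (subst Bochner_Integration.integral_diff) (auto simp: \<nu>_def)
      finally show ?thesis .
    qed
    ultimately show ?case
      by (simp add: mult.commute[of _ c] mult.left_commute[of _ c])
  next
    case (add f g)
    then show ?case
      using lin[of f g 1] by (simp add: distrib_left int_s)
  next
    case (lim f F)
    \<comment> \<open>The approximants satisfy
      \<open>\<bar>F i t\<bar> \<le> 2 * \<bar>f t\<bar>\<close>, whence the factor 3.\<close>
    have "(\<lambda>i. \<integral>t. \<bar>F i t - f t\<bar> \<partial>M) \<longlonglongrightarrow> (\<integral>t. 0 \<partial>M)"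
    proof (rule integral_dominated_convergence[where w="\<lambda>t. 3 * \<bar>f t\<bar>"])
      show "AE t in M. (\<lambda>i. \<bar>F i t - f t\<bar>) \<longlonglongrightarrow> 0"
        by (intro AE_I2 tendsto_rabs_zero LIM_zero lim(2))
      show "AE t in M. norm \<bar>F i t - f t\<bar> \<le> 3 * \<bar>f t\<bar>" for i
        using lim(3)[of _ i] by (intro AE_I2) force
    qed (use lim in auto)
    then have lim0: "(\<lambda>i. \<integral>t. \<bar>F i t - f t\<bar> \<partial>M) \<longlonglongrightarrow> 0" by simp
    \<comment> \<open>Both \<open>L\<close> and integration against \<open>s\<close> are 1-Lipschitz
      in the L1 norm, so the identity passes to the limit.\<close>
    have "\<bar>L (F i) - L f\<bar> \<le> (\<integral>t. \<bar>F i t - f t\<bar> \<partial>M)" for i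
      using lin[of f "F i" "-1"] bnd[of "\<lambda>t. - 1 * f t + F i t"] lim(1)[of i] lim(4)
      by (simp add: algebra_simps)
    then have "(\<lambda>i. L (F i) - L f) \<longlonglongrightarrow> 0"
      by (intro Lim_null_comparison[OF _ lim0]) auto
    moreover have "(\<lambda>i. (\<integral>t. s t * F i t \<partial>M) - (\<integral>t. s t * f t \<partial>M)) \<longlonglongrightarrow> 0"
    proof (rule Lim_null_comparison[OF always_eventually lim0], rule allI)
      fix i
      have "norm ((\<integral>t. s t * F i t \<partial>M) - (\<integral>t. s t * f t \<partial>M)) = \<bar>\<integral>t. s t * (F i t - f t) \<partial>M\<bar>"
        using lim(1)[of i] lim(4) by (simp add: right_diff_distrib int_s)
      also have "\<dots> \<le> (\<integral>t. \<bar>s t * (F i t - f t)\<bar> \<partial>M)"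
        by (rule integral_abs_bound)
      also have "\<dots> \<le> (\<integral>t. \<bar>F i t - f t\<bar> \<partial>M)"
        using lim(1)[of i] lim(4) s_le
        by (intro integral_mono int_s integrable_abs) (auto simp: abs_mult intro!: mult_left_le_one_le)
      finally show "norm ((\<integral>t. s t * F i t \<partial>M) - (\<integral>t. s t * f t \<partial>M)) \<le> (\<integral>t. \<bar>F i t - f t\<bar> \<partial>M)" .
    qed
    ultimately have "(\<lambda>i. L (F i)) \<longlonglongrightarrow> L f" "(\<lambda>i. L (F i)) \<longlonglongrightarrow> (\<integral>t. s t * f t \<partial>M)"
      unfolding lim(5) by (simp_all add: LIM_zero_cancel)
    then show ?case
      by (rule LIMSEQ_unique)
  qed
  with s_meas s_le show ?thesis by (rule that)
qed

text \<open>A family, indexed by \<open>'i\<close>, of elements of the unit ball of the dual of \<open>L\<^sub>1\<close>. The functionals are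
  total, with value \<open>0\<close> at nonintegrable functions, so that the weak* topology is the product topology
  of the function type.\<close>

definition L1_unit_ball :: "'a measure \<Rightarrow> ('i \<times> ('a \<Rightarrow> real) \<Rightarrow> real) set" where
  "L1_unit_ball M = {L.
     (\<forall>j f. \<bar>L (j, f)\<bar> \<le> (if integrable M f then \<integral>t. \<bar>f t\<bar> \<partial>M else 0)) \<and>
     (\<forall>j a f g. integrable M f \<longrightarrow> integrable M g \<longrightarrow>
        L (j, \<lambda>t. a * f t + g t) = a * L (j, f) + L (j, g))}"

text \<open>Banach-Alaoglu in coordinates: the bounds alone give a product of compact intervals,
  compact by Tychonoff, and linearity cuts out a closed subset.\<close>

lemma compact_L1_unit_ball: "compact (L1_unit_ball M :: ('i \<times> ('a \<Rightarrow> real) \<Rightarrow> real) set)"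
proof -
  define B :: "'i \<times> ('a \<Rightarrow> real) \<Rightarrow> real" where
    "B p = (if integrable M (snd p) then \<integral>t. \<bar>snd p t\<bar> \<partial>M else 0)" for p
  define E where "E = {L :: 'i \<times> ('a \<Rightarrow> real) \<Rightarrow> real. \<forall>j a f g. integrable M f \<longrightarrow> integrable M g \<longrightarrow>
        L (j, \<lambda>t. a * f t + g t) = a * L (j, f) + L (j, g)}"
  have "compactin (product_topology (\<lambda>_. euclidean) UNIV) (PiE UNIV (\<lambda>p. {- B p..B p}))"
    by (simp add: compactin_PiE)
  then have "compact (PiE UNIV (\<lambda>p. {- B p..B p}))"
    by (simp add: euclidean_product_topology)
  \<comment> \<open>Each linearity condition equates continuous functions of three coordinates of
    \<open>L\<close>, and its integrability premises do not depend on \<open>L\<close>.\<close>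
  moreover have "closed E"
    unfolding E_def
    by (intro closed_Collect_all closed_Collect_imp closed_Collect_eq continuous_intros
        continuous_on_product_coordinates) auto
  ultimately have "compact (PiE UNIV (\<lambda>p. {- B p..B p}) \<inter> E)"
    by (rule compact_Int_closed)
  also have "PiE UNIV (\<lambda>p. {- B p..B p}) \<inter> E = L1_unit_ball M"
  proof -
    have "PiE UNIV (\<lambda>p. {- B p..B p}) = {L. \<forall>p. \<bar>L p\<bar> \<le> B p}"
      by (auto simp: PiE_UNIV_domain Pi_iff abs_le_iff minus_le_iff)
    then show ?thesis
      by (simp add: L1_unit_ball_def E_def B_def Int_def)
  qed
  finally show ?thesis .
qed

section \<open>Functionals whose first density ranges over a band\<close>

text \<open>The shape that \<open>phi_superdifferential\<close> will turn out to have, isolated for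
  general \<open>m\<close>, \<open>r\<close>, \<open>q\<close>. Essential boundedness of
  \<open>w\<close> is not demanded because it follows from that of \<open>m\<close> and
  \<open>r\<close>.\<close>

definition band ::
    "real \<Rightarrow> (real \<Rightarrow> real^'n) \<Rightarrow> (real \<Rightarrow> real^'n) \<Rightarrow> (real \<Rightarrow> real^'n)
      \<Rightarrow> ((real \<Rightarrow> real^'n) \<Rightarrow> real) set" where
  "band T m r q = {traj_functional T w q | w. w \<in> borel_measurable (lebesgue_on {0..T}) \<and>
     (AE t in lebesgue_on {0..T}. \<forall>j. \<bar>w t $ j - m t $ j\<bar> \<le> r t $ j)}"

lemma L_infinity_band:
  fixes m r w :: "real \<Rightarrow> real^'n"
  assumes m: "m \<in> L_infinity T" and r: "r \<in> L_infinity T"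
    and w: "w \<in> borel_measurable (lebesgue_on {0..T})"
      "AE t in lebesgue_on {0..T}. \<forall>j. \<bar>w t $ j - m t $ j\<bar> \<le> r t $ j"
  shows "w \<in> L_infinity T"
proof -
  obtain C where C: "AE t in lebesgue_on {0..T}. norm (m t) \<le> C"
    using m by (auto simp: L_infinity_def)
  obtain D where D: "AE t in lebesgue_on {0..T}. norm (r t) \<le> D"
    using r by (auto simp: L_infinity_def)
  have "AE t in lebesgue_on {0..T}. norm (w t) \<le> (\<Sum>j\<in>(UNIV::'n set). C + D)"
    using C D w(2)
  proof eventually_elim
    case (elim t)
    have "\<bar>w t $ j\<bar> \<le> C + D" for j
      using elim(1,2) elim(3)[rule_format, of j] component_le_norm_cart[of "m t" j]
        component_le_norm_cart[of "r t" j]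
      by linarith
    then show ?case
      by (intro order_trans[OF norm_le_l1_cart] sum_mono)
  qed
  then show ?thesis
    using w(1) by (auto simp: L_infinity_def)
qed

lemma L_infinity_borel_measurable: "w \<in> L_infinity T \<Longrightarrow> w \<in> borel_measurable (lebesgue_on {0..T})"
  by (simp add: L_infinity_def)

lemma integrable_L_infinity_component:
  fixes r :: "real \<Rightarrow> real^'n"
  assumes r: "r \<in> L_infinity T" and g: "g \<in> trajectories T"
  shows "integrable (lebesgue_on {0..T}) (\<lambda>t. r t $ j * g t $ j)"
proof -
  \<comment> \<open>The product of two components is an inner product with a vector supported on
    axis \<open>j\<close>, so the result for inner products applies.\<close>
  have "(\<lambda>t. axis j (r t $ j)) \<in> L_infinity T"
  proof -
    obtain C where C: "AE t in lebesgue_on {0..T}. norm (r t) \<le> C"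
      using r by (auto simp: L_infinity_def)
    have "norm (axis j (r t $ j)) \<le> norm (r t)" for t
      using component_le_norm_cart[of "r t" j] by (simp add: norm_eq_sqrt_inner[of "axis _ _"] inner_axis_axis)
    then have "AE t in lebesgue_on {0..T}. norm (axis j (r t $ j)) \<le> C"
      using C by (auto elim!: eventually_mono intro: order_trans)
    moreover have "(\<lambda>t. axis j (r t $ j)) \<in> borel_measurable (lebesgue_on {0..T})"
      using L_infinity_borel_measurable[OF r]
      by (intro borel_measurable_vecI) (simp add: axis_def)
    ultimately show ?thesis by (auto simp: L_infinity_def)
  qed
  from integrable_trajectory_inner(1)[OF this g] show ?thesis
    by (simp add: inner_axis')
qed

text \<open>Substituting \<open>w $ j = m $ j + r $ j * s j\<close> with
  \<open>\<bar>s j\<bar> \<le> 1\<close> lets \<open>s j\<close> act as an element of the dual unit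
  ball on the integrable function \<open>r $ j * g $ j\<close>. A density \<open>w\<close> yields
  \<open>L\<close> by integration against \<open>s\<close>; conversely \<open>L\<close> yields
  \<open>s\<close> by the representation of the dual of L1.\<close>

lemma band_eq_image:
  fixes m r q :: "real \<Rightarrow> real^'n"
  assumes m: "m \<in> L_infinity T" and r: "r \<in> L_infinity T" and q: "q \<in> L_infinity T"
    and r0: "\<And>t j. 0 \<le> r t $ j"
  shows "band T m r q = (\<lambda>L. \<lambda>g\<in>trajectories T. traj_functional T m q g +
    (\<Sum>j\<in>UNIV. L (j, \<lambda>t. r t $ j * g t $ j))) ` L1_unit_ball (lebesgue_on {0..T})"
    (is "_ = ?F ` ?K")
proof -
  let ?M = "lebesgue_on {0..T}"
  interpret finite_measure ?M by (rule finite_measure_lebesgue_on_Icc)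
  note [measurable] = L_infinity_borel_measurable[OF m] L_infinity_borel_measurable[OF r]
    L_infinity_borel_measurable[OF q]
  \<comment> \<open>The computation common to both inclusions.\<close>
  have F_eq: "traj_functional T w q = ?F L"
    if L: "\<And>j f. integrable ?M f \<Longrightarrow> L (j, f) = (\<integral>t. s j t * f t \<partial>?M)"
      and s: "\<And>j. s j \<in> borel_measurable ?M" "\<And>j t. \<bar>s j t\<bar> \<le> 1"
      and w: "w \<in> L_infinity T" "AE t in ?M. w t = m t + (\<chi> j. r t $ j * s j t)" for w s L
  proof
    fix g
    show "traj_functional T w q g = ?F L g"
    proof (cases "g \<in> trajectories T")
      case g: True
      note [measurable] = s(1) L_infinity_borel_measurable[OF w(1)] trajectories_measurable[OF g]
      note int = integrable_L_infinity_component[OF r g]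
      have ints: "integrable ?M (\<lambda>t. s j t * (r t $ j * g t $ j))" for j
        by (rule Bochner_Integration.integrable_bound[OF int[of j]])
          (auto simp: abs_mult s(2) intro!: mult_left_le_one_le)
      have "(\<integral>t. w t \<bullet> g t \<partial>?M) = (\<integral>t. m t \<bullet> g t + (\<Sum>j\<in>UNIV. s j t * (r t $ j * g t $ j)) \<partial>?M)"
        using w(2) by (intro integral_cong_AE)
          (auto elim!: eventually_mono simp: inner_add_left inner_vec_def algebra_simps sum.distrib)
      also have "\<dots> = (\<integral>t. m t \<bullet> g t \<partial>?M) + (\<Sum>j\<in>UNIV. \<integral>t. s j t * (r t $ j * g t $ j) \<partial>?M)"
        using ints integrable_trajectory_inner(1)[OF m g] by simp
      finally show ?thesis
        using g by (simp add: traj_functional_def L[OF int])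
    qed (simp add: traj_functional_def)
  qed
  show ?thesis
  proof (intro equalityI subsetI)
    fix v assume "v \<in> band T m r q"
    then obtain w where v: "v = traj_functional T w q" and w: "w \<in> borel_measurable ?M"
      and band: "AE t in ?M. \<forall>j. \<bar>w t $ j - m t $ j\<bar> \<le> r t $ j"
      by (auto simp: band_def)
    note [measurable] = w
    \<comment> \<open>The band condition holds only almost everywhere, so the quotient is clipped to
      bound \<open>s\<close> at every point. Where \<open>r\<close> is 0 the value of
      \<open>s\<close> is immaterial: there \<open>w\<close> equals \<open>m\<close> in that
      coordinate.\<close>
    define s where "s j t = max (-1) (min 1 ((w t $ j - m t $ j) / r t $ j))" for j t
    have s: "s j \<in> borel_measurable ?M" "\<bar>s j t\<bar> \<le> 1" for j t
      by (auto simp: s_def[abs_def])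
    \<comment> \<open>The value 0 at nonintegrable functions is the one prescribed by
      \<open>L1_unit_ball\<close>.\<close>
    define L where "L p = (if integrable ?M (snd p) then \<integral>t. s (fst p) t * snd p t \<partial>?M else 0)" for p
    have ints: "integrable ?M (\<lambda>t. s j t * f t)" if "integrable ?M f" for j f
      by (rule Bochner_Integration.integrable_bound[OF that])
        (use s that in \<open>auto simp: abs_mult intro!: mult_left_le_one_le\<close>)
    have "\<bar>L (j, f)\<bar> \<le> (\<integral>t. \<bar>f t\<bar> \<partial>?M)" if f: "integrable ?M f" for j f
    proof -
      have "\<bar>\<integral>t. s j t * f t \<partial>?M\<bar> \<le> (\<integral>t. \<bar>f t\<bar> \<partial>?M)"
        by (intro order_trans[OF integral_abs_bound integral_mono] integrable_abs ints f)
          (simp add: abs_mult mult_left_le_one_le s(2))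
      then show ?thesis using f by (simp add: L_def)
    qed
    moreover have "L (j, f) = 0" if "\<not> integrable ?M f" for j f
      using that by (simp add: L_def)
    moreover have "L (j, \<lambda>t. a * f t + g t) = a * L (j, f) + L (j, g)"
      if fg: "integrable ?M f" "integrable ?M g" for j a f g
      using fg ints[OF fg(1), of j] ints[OF fg(2), of j]
      by (simp add: L_def distrib_left mult.left_commute[of _ a])
    ultimately have "L \<in> ?K"
      by (simp add: L1_unit_ball_def)
    moreover have "traj_functional T w q = ?F L"
    proof (rule F_eq)
      show "L (j, f) = (\<integral>t. s j t * f t \<partial>?M)" if "integrable ?M f" for j f
        using that by (simp add: L_def)
      show "w \<in> L_infinity T"
        using L_infinity_band[OF m r w band] .
      show "AE t in ?M. w t = m t + (\<chi> j. r t $ j * s j t)"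
        using band
      proof eventually_elim
        case (elim t)
        have "w t $ j = m t $ j + r t $ j * s j t" for j
        proof (cases "r t $ j = 0")
          case True
          then show ?thesis using elim[rule_format, of j] by simp
        next
          case False
          then have "0 < r t $ j" using r0[of t j] by simp
          then have "\<bar>(w t $ j - m t $ j) / r t $ j\<bar> \<le> 1"
            using elim by (simp add: abs_divide)
          moreover have "max (-1) (min 1 a) = a" if "\<bar>a\<bar> \<le> 1" for a :: real
            using that by auto
          ultimately have "s j t = (w t $ j - m t $ j) / r t $ j"
            by (simp only: s_def)
          with False show ?thesis by simp
        qed
        then show ?case by (simp add: vec_eq_iff)
      qed
    qed (use s in auto)
    ultimately show "v \<in> ?F ` ?K"
      unfolding v by blast
  next
    fix v assume "v \<in> ?F ` ?K"
    then obtain L where v: "v = ?F L" and L: "L \<in> ?K" by blast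
    have "\<exists>s. s \<in> borel_measurable ?M \<and> (\<forall>t. \<bar>s t\<bar> \<le> 1) \<and>
        (\<forall>f. integrable ?M f \<longrightarrow> L (j, f) = (\<integral>t. s t * f t \<partial>?M))" for j
    proof (rule bounded_functional_on_L1_representation[of ?M "\<lambda>f. L (j, f)"])
      show "finite_measure ?M" by (rule finite_measure_lebesgue_on_Icc)
      show "L (j, \<lambda>t. a * f t + g t) = a * L (j, f) + L (j, g)"
        if "integrable ?M f" "integrable ?M g" for a f g
        using L that by (simp add: L1_unit_ball_def)
      have bnd: "\<bar>L (j, f)\<bar> \<le> (if integrable ?M f then \<integral>t. \<bar>f t\<bar> \<partial>?M else 0)" for f
        using L by (simp add: L1_unit_ball_def)
      show "\<bar>L (j, f)\<bar> \<le> (\<integral>t. \<bar>f t\<bar> \<partial>?M)" if "integrable ?M f" for f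
        using bnd[of f] that by simp
    qed blast
    then obtain s where s: "\<And>j. s j \<in> borel_measurable ?M" "\<And>j t. \<bar>s j t\<bar> \<le> 1"
      "\<And>j f. integrable ?M f \<Longrightarrow> L (j, f) = (\<integral>t. s j t * f t \<partial>?M)"
      by metis
    note [measurable] = s(1)
    define w where "w t = m t + (\<chi> j. r t $ j * s j t)" for t
    have w: "w \<in> borel_measurable ?M"
      by (rule borel_measurable_vecI) (simp add: w_def)
    have band: "AE t in ?M. \<forall>j. \<bar>w t $ j - m t $ j\<bar> \<le> r t $ j"
      using s(2) r0 by (auto simp: w_def abs_mult intro!: mult_left_le)
    have "traj_functional T w q = ?F L"
      by (rule F_eq[OF s(3) s(1,2) L_infinity_band[OF m r w band]]) (simp_all add: w_def)
    then show "v \<in> band T m r q"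
      unfolding v band_def mem_Collect_eq using w band by (intro exI[of _ w]) simp
  qed
qed

text \<open>The map in \<open>band_eq_image\<close> is continuous: its value at each
  \<open>g\<close> is a constant plus a finite sum of evaluations of \<open>L\<close>. The band is
  thus a continuous image of a compact set.\<close>

lemma compactin_band:
  fixes m r q :: "real \<Rightarrow> real^'n"
  assumes T: "0 < T" and m: "m \<in> L_infinity T" and r: "r \<in> L_infinity T" and q: "q \<in> L_infinity T"
    and r0: "\<And>t j. 0 \<le> r t $ j"
  shows "compactin (weak_star_topology T) (band T m r q)" "band T m r q \<subseteq> traj_dual T"
proof -
  show sub: "band T m r q \<subseteq> traj_dual T"
    using traj_functional_in_traj_dual[OF T _ q] L_infinity_band[OF m r] by (auto simp: band_def)
  have "continuous_map euclidean (product_topology (\<lambda>_. euclideanreal) (trajectories T))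
     (\<lambda>L. \<lambda>g\<in>trajectories T. traj_functional T m q g + (\<Sum>j\<in>UNIV. L (j, \<lambda>t. r t $ j * g t $ j)))"
    unfolding continuous_map_componentwise
    by (auto intro!: continuous_intros simp: continuous_map_iff_continuous2)
  from image_compactin[OF _ this, of "L1_unit_ball (lebesgue_on {0..T})"]
  show "compactin (weak_star_topology T) (band T m r q)"
    using sub
    by (simp add: weak_star_topology_def compactin_subtopology band_eq_image[OF m r q r0]
        compact_L1_unit_ball)
qed

text \<open>Convex combinations of functionals are represented by those of their first densities,
  and the band condition is convex at each point.\<close>

lemma convex_functionals_band:
  fixes m r q :: "real \<Rightarrow> real^'n"
  assumes m: "m \<in> L_infinity T" and r: "r \<in> L_infinity T" and q: "q \<in> L_infinity T"
  shows "convex_functionals T (band T m r q)"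
  unfolding convex_functionals_def
proof (intro ballI)
  let ?M = "lebesgue_on {0..T}"
  fix v w and u :: real assume "v \<in> band T m r q" "w \<in> band T m r q" and u: "u \<in> {0..1}"
  then obtain v' w' where v: "v = traj_functional T v' q" and [measurable]: "v' \<in> borel_measurable ?M"
      and vb: "AE t in ?M. \<forall>j. \<bar>v' t $ j - m t $ j\<bar> \<le> r t $ j"
      and w: "w = traj_functional T w' q" and [measurable]: "w' \<in> borel_measurable ?M"
      and wb: "AE t in ?M. \<forall>j. \<bar>w' t $ j - m t $ j\<bar> \<le> r t $ j"
    by (auto simp: band_def)
  define z where "z t = (1 - u) *\<^sub>R v' t + u *\<^sub>R w' t" for t
  have "(\<lambda>g\<in>trajectories T. (1 - u) * v g + u * w g) = traj_functional T z q"
  proof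
    fix g show "(\<lambda>g\<in>trajectories T. (1 - u) * v g + u * w g) g = traj_functional T z q g"
    proof (cases "g \<in> trajectories T")
      case g: True
      have "integrable ?M (\<lambda>t. v' t \<bullet> g t)" "integrable ?M (\<lambda>t. w' t \<bullet> g t)"
        by (intro integrable_trajectory_inner(1)[OF L_infinity_band[OF m r _ vb] g]
          integrable_trajectory_inner(1)[OF L_infinity_band[OF m r _ wb] g]; measurable)+
      then have "(\<integral>t. z t \<bullet> g t \<partial>?M) = (1 - u) * (\<integral>t. v' t \<bullet> g t \<partial>?M) + u * (\<integral>t. w' t \<bullet> g t \<partial>?M)"
        by (simp add: z_def inner_add_left)
      with g show ?thesis
        by (simp add: v w traj_functional_def algebra_simps)
    qed (simp add: traj_functional_def)
  qed
  moreover have "AE t in ?M. \<forall>j. \<bar>z t $ j - m t $ j\<bar> \<le> r t $ j"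
    using vb wb
  proof eventually_elim
    case (elim t)
    show ?case
    proof
      fix j
      have "z t $ j - m t $ j = (1 - u) * (v' t $ j - m t $ j) + u * (w' t $ j - m t $ j)"
        by (simp add: z_def algebra_simps)
      also have "\<bar>\<dots>\<bar> \<le> (1 - u) * \<bar>v' t $ j - m t $ j\<bar> + u * \<bar>w' t $ j - m t $ j\<bar>"
        using u by (intro order_trans[OF abs_triangle_ineq]) (simp add: abs_mult)
      also have "\<dots> \<le> (1 - u) * r t $ j + u * r t $ j"
        using u elim by (intro add_mono mult_left_mono) auto
      finally show "\<bar>z t $ j - m t $ j\<bar> \<le> r t $ j" by (simp add: algebra_simps)
    qed
  qed
  moreover have "z \<in> borel_measurable ?M"
    unfolding z_def[abs_def] by measurable
  ultimately show "(\<lambda>g\<in>trajectories T. (1 - u) * v g + u * w g) \<in> band T m r q"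
    by (auto simp: band_def)
qed

text \<open>Minimisation is done pointwise under the integral: the explicit choice
  \<open>m - r * sgn g\<close> in each coordinate is measurable and minimises the integrand among
  all densities in the band.\<close>

lemma band_arg_min:
  fixes m r q g :: "real \<Rightarrow> real^'n"
  assumes m: "m \<in> L_infinity T" and r: "r \<in> L_infinity T" and q: "q \<in> L_infinity T"
    and r0: "\<And>t j. 0 \<le> r t $ j" and g: "g \<in> trajectories T"
  obtains w where "is_arg_min (\<lambda>v. v g) (\<lambda>v. v \<in> band T m r q) w"
    "w g = (LINT t|lebesgue_on {0..T}. m t \<bullet> g t + q t \<bullet> traj_deriv T g t - (\<Sum>j\<in>UNIV. r t $ j * \<bar>g t $ j\<bar>))"
proof -
  let ?M = "lebesgue_on {0..T}"
  note [measurable] = L_infinity_borel_measurable[OF m] L_infinity_borel_measurable[OF r]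
    L_infinity_borel_measurable[OF q] trajectories_measurable[OF g]
  define w where "w t = m t - (\<chi> j. r t $ j * sgn (g t $ j))" for t
  have wg: "w t \<bullet> g t = m t \<bullet> g t - (\<Sum>j\<in>UNIV. r t $ j * \<bar>g t $ j\<bar>)" for t
    by (simp add: w_def inner_diff_left inner_vec_def abs_sgn algebra_simps sum_subtractf)
  have w: "w \<in> borel_measurable ?M"
    by (rule borel_measurable_vecI) (simp add: w_def)
  have band: "AE t in ?M. \<forall>j. \<bar>w t $ j - m t $ j\<bar> \<le> r t $ j"
    using r0 by (auto simp: w_def abs_mult sgn_if)
  note intw = integrable_trajectory_inner(1)[OF L_infinity_band[OF m r w band] g]
  have "traj_functional T w q g \<le> v g" if v_band: "v \<in> band T m r q" for v
  proof -
    obtain v' where v: "v = traj_functional T v' q" and v': "v' \<in> borel_measurable ?M"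
      and vb: "AE t in ?M. \<forall>j. \<bar>v' t $ j - m t $ j\<bar> \<le> r t $ j"
      using v_band by (auto simp: band_def)
    have "(\<integral>t. w t \<bullet> g t \<partial>?M) \<le> (\<integral>t. v' t \<bullet> g t \<partial>?M)"
    proof (rule integral_mono_AE[OF intw])
      show "integrable ?M (\<lambda>t. v' t \<bullet> g t)"
        by (rule integrable_trajectory_inner(1)[OF L_infinity_band[OF m r v' vb] g])
      show "AE t in ?M. w t \<bullet> g t \<le> v' t \<bullet> g t"
        using vb
      proof eventually_elim
        case (elim t)
        have "\<bar>(v' t - m t) \<bullet> g t\<bar> \<le> (\<Sum>j\<in>UNIV. r t $ j * \<bar>g t $ j\<bar>)"
          unfolding inner_vec_def using elim
          by (intro order_trans[OF sum_abs] sum_mono) (auto simp: abs_mult intro!: mult_right_mono)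
        then show ?case
          unfolding wg by (simp add: inner_diff_left)
      qed
    qed
    then show ?thesis using g by (simp add: v traj_functional_def)
  qed
  moreover have "traj_functional T w q \<in> band T m r q"
    using w band by (auto simp: band_def)
  ultimately have "is_arg_min (\<lambda>v. v g) (\<lambda>v. v \<in> band T m r q) (traj_functional T w q)"
    by (auto simp: is_arg_min_linorder)
  moreover have "traj_functional T w q g = (\<integral>t. w t \<bullet> g t + q t \<bullet> traj_deriv T g t \<partial>?M)"
    using g intw integrable_trajectory_inner(2)[OF q g] by (simp add: traj_functional_def)
  ultimately show ?thesis
    by (intro that[of "traj_functional T w q"]) (simp_all add: wg algebra_simps)
qed

section \<open>The integral functional\<close>

lemma L_infinity_vecI:
  fixes f :: "real \<Rightarrow> real^'n"
  assumes "f \<in> borel_measurable (lebesgue_on {0..T})"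
    and "\<And>t j. t \<in> {0..T} \<Longrightarrow> \<bar>f t $ j\<bar> \<le> C"
  shows "f \<in> L_infinity T"
proof -
  have "AE t in lebesgue_on {0..T}. norm (f t) \<le> (\<Sum>j\<in>(UNIV::'n set). C)"
    using assms(2) by (intro AE_I2 order_trans[OF norm_le_l1_cart] sum_mono) auto
  then show ?thesis using assms(1) unfolding L_infinity_def by blast
qed

lemma borel_measurable_traj_pair:
  fixes x :: "real \<Rightarrow> real^'n"
  assumes "x \<in> trajectories T"
  shows "(\<lambda>t. (x t, traj_deriv T x t)) \<in> borel_measurable (lebesgue_on {0..T})"
  using trajectories_measurable[OF assms] by (rule borel_measurable_Pair)

lemma superdifferential_coeffs_L_infinity:
  fixes x :: "real \<Rightarrow> real^'n"
  assumes b: "\<And>i. 0 \<le> b i" and x: "x \<in> trajectories T"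
  shows "(\<lambda>t. grad1 A b (x t, traj_deriv T x t)) \<in> L_infinity T"
    "(\<lambda>t. grad2 A b (x t, traj_deriv T x t)) \<in> L_infinity T"
    "(\<lambda>t. spread A b (x t, traj_deriv T x t)) \<in> L_infinity T"
proof -
  obtain C where C: "0 \<le> C" "\<And>y j. \<bar>grad1 A b y $ j\<bar> \<le> C * norm y"
    "\<And>y j. \<bar>grad2 A b y $ j\<bar> \<le> C * norm y" "\<And>y j. \<bar>spread A b y $ j\<bar> \<le> C * norm y"
    by (rule superdifferential_coeffs_linear_growth[where A = A and b = b, OF b]) blast
  obtain R where R: "\<And>t. t \<in> {0..T} \<Longrightarrow> norm (x t, traj_deriv T x t) \<le> R"
    by (rule trajectories_bounded[OF x]) blast
  have le: "C * norm (x t, traj_deriv T x t) \<le> C * R" if "t \<in> {0..T}" for t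
    using R[OF that] C(1) by (rule mult_left_mono)
  note [measurable] = borel_measurable_traj_pair[OF x]
  show "(\<lambda>t. grad1 A b (x t, traj_deriv T x t)) \<in> L_infinity T"
    by (rule L_infinity_vecI[where C = "C * R"], measurable) (rule order_trans[OF C(2) le])
  show "(\<lambda>t. grad2 A b (x t, traj_deriv T x t)) \<in> L_infinity T"
    by (rule L_infinity_vecI[where C = "C * R"], measurable) (rule order_trans[OF C(3) le])
  show "(\<lambda>t. spread A b (x t, traj_deriv T x t)) \<in> L_infinity T"
    by (rule L_infinity_vecI[where C = "C * R"], measurable) (rule order_trans[OF C(4) le])
qed

lemma radius_nonneg: "\<forall>i\<in>I. abar i > 0 \<Longrightarrow> 0 \<le> radius I abar i"
  by (simp add: radius_def less_imp_le)

text \<open>By the box form of the superdifferential, the pointwise inclusion confines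
  \<open>w1\<close> to the band and forces \<open>w2\<close> to equal \<open>grad2\<close> almost
  everywhere.\<close>

lemma phi_superdifferential_eq_band:
  fixes A :: "real^'n^'n" and x :: "real \<Rightarrow> real^'n"
  assumes T: "0 < T" and abar: "\<forall>i\<in>I. abar i > 0" and x: "x \<in> trajectories T"
  defines "b \<equiv> radius I abar"
  shows "phi_superdifferential A I abar T x =
    band T (\<lambda>t. grad1 A b (x t, traj_deriv T x t)) (\<lambda>t. spread A b (x t, traj_deriv T x t))
      (\<lambda>t. grad2 A b (x t, traj_deriv T x t))"
    (is "_ = band T ?m ?r ?q")
proof -
  let ?M = "lebesgue_on {0..T}"
  have b: "0 \<le> b i" for i using radius_nonneg[OF abar] by (simp add: b_def)
  note mem = superdifferential_coeffs_L_infinity[OF b x, of A]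
  have sd: "(w1 t, w2 t) \<in> superdifferential (h_sq A I abar) (x t, traj_deriv T x t) \<longleftrightarrow>
      (\<forall>j. \<bar>w1 t $ j - ?m t $ j\<bar> \<le> ?r t $ j) \<and> w2 t = ?q t" for w1 w2 t
    by (simp add: superdifferential_h_sq[OF abar] b_def)
  show ?thesis
  proof (intro equalityI subsetI)
    fix v assume "v \<in> phi_superdifferential A I abar T x"
    then obtain w1 w2 where v: "v \<in> traj_dual T" and w: "w1 \<in> L_infinity T" "w2 \<in> L_infinity T"
      and v_eq: "\<forall>g\<in>trajectories T. v g = (LINT t|?M. w1 t \<bullet> g t) + (LINT t|?M. w2 t \<bullet> traj_deriv T g t)"
      and ae: "AE t in ?M. (\<forall>j. \<bar>w1 t $ j - ?m t $ j\<bar> \<le> ?r t $ j) \<and> w2 t = ?q t"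
      unfolding phi_superdifferential_def sd by auto
    \<comment> \<open>Off the trajectories the two sides agree because both are
      \<open>extensional\<close>.\<close>
    have "v = traj_functional T w1 w2"
    proof
      fix g show "v g = traj_functional T w1 w2 g"
        using v v_eq by (cases "g \<in> trajectories T")
          (auto simp: traj_functional_def traj_dual_def extensional_def)
    qed
    also have "\<dots> = traj_functional T w1 ?q"
      using ae by (intro traj_functional_cong_AE L_infinity_borel_measurable w mem)
        (auto elim!: eventually_mono)
    finally show "v \<in> band T ?m ?r ?q"
      using ae L_infinity_borel_measurable[OF w(1)] unfolding band_def
      by (auto elim!: eventually_mono intro!: exI[of _ w1])
  next
    fix v assume v_band: "v \<in> band T ?m ?r ?q"
    then obtain w where v: "v = traj_functional T w ?q" and w: "w \<in> borel_measurable ?M"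
      and ae: "AE t in ?M. \<forall>j. \<bar>w t $ j - ?m t $ j\<bar> \<le> ?r t $ j"
      by (auto simp: band_def)
    have wL: "w \<in> L_infinity T"
      by (rule L_infinity_band[OF mem(1,3) w ae])
    have "v \<in> traj_dual T"
      unfolding v by (rule traj_functional_in_traj_dual[OF T wL mem(2)])
    moreover have "v g = (LINT t|?M. w t \<bullet> g t) + (LINT t|?M. ?q t \<bullet> traj_deriv T g t)"
      if "g \<in> trajectories T" for g
      using that by (simp add: v traj_functional_def)
    ultimately show "v \<in> phi_superdifferential A I abar T x"
      unfolding phi_superdifferential_def sd mem_Collect_eq using ae wL mem(2)
      by (intro conjI exI[of _ w] exI[of _ ?q]) simp_all
  qed
qed

section \<open>Differentiation under the integral sign\<close>

lemma integrable_h_sq: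
  fixes z :: "real \<Rightarrow> (real^'n) \<times> (real^'n)"
  assumes abar: "\<forall>i\<in>I. abar i > 0" and z: "z \<in> borel_measurable (lebesgue_on {0..T})"
    "\<And>t. t \<in> {0..T} \<Longrightarrow> norm (z t) \<le> R"
  shows "integrable (lebesgue_on {0..T}) (\<lambda>t. h_sq A I abar (z t))"
proof -
  interpret finite_measure "lebesgue_on {0..T}" by (rule finite_measure_lebesgue_on_Icc)
  obtain C where C: "\<And>y d \<alpha>. norm y \<le> \<bar>R\<bar> \<Longrightarrow> norm d \<le> \<bar>R\<bar> \<Longrightarrow> 0 < \<alpha> \<Longrightarrow> \<alpha> \<le> 1 \<Longrightarrow>
    \<bar>h_sq A I abar (y + \<alpha> *\<^sub>R d) - h_sq A I abar y\<bar> \<le> C * \<alpha>"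
    by (rule h_sq_increment_bound[OF abar]) blast
  show ?thesis
  proof (rule integrable_const_bound[where B="C + \<bar>h_sq A I abar 0\<bar>"])
    \<comment> \<open>The increment bound is used from the origin, in direction \<open>z t\<close>
      with step 1.\<close>
    have "norm (h_sq A I abar (z t)) \<le> C + \<bar>h_sq A I abar 0\<bar>" if "t \<in> {0..T}" for t
      using C[of 0 "z t" 1] order_trans[OF z(2)[OF that] abs_ge_self] by simp
    then show "AE t in lebesgue_on {0..T}. norm (h_sq A I abar (z t)) \<le> C + \<bar>h_sq A I abar 0\<bar>"
      by (intro AE_I2) simp
    show "(\<lambda>t. h_sq A I abar (z t)) \<in> borel_measurable (lebesgue_on {0..T})"
      using z(1) borel_measurable_h_sq[OF abar] by measurable
  qed
qed

text \<open>Dominated convergence: the quotients converge pointwise by \<open>h_sq_dir_deriv\<close>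
  and are bounded by the constant of \<open>h_sq_increment_bound\<close>, which is integrable on
  [0,T].\<close>

lemma phi_dir_deriv:
  fixes A :: "real^'n^'n" and x g :: "real \<Rightarrow> real^'n"
  assumes abar: "\<forall>i\<in>I. abar i > 0" and x: "x \<in> trajectories T" and g: "g \<in> trajectories T"
  shows "((\<lambda>\<alpha>. (phi A I abar T (\<lambda>t. x t + \<alpha> *\<^sub>R g t) - phi A I abar T x) / \<alpha>) \<longlongrightarrow>
    (LINT t|lebesgue_on {0..T}. dir_deriv A (radius I abar) (x t, traj_deriv T x t) (g t, traj_deriv T g t)))
    (at_right 0)"
proof -
  let ?M = "lebesgue_on {0..T}"
  interpret finite_measure ?M by (rule finite_measure_lebesgue_on_Icc)
  define y where "y t = (x t, traj_deriv T x t)" for t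
  define d where "d t = (g t, traj_deriv T g t)" for t
  have y_meas [measurable]: "y \<in> borel_measurable ?M" and d_meas [measurable]: "d \<in> borel_measurable ?M"
    unfolding y_def[abs_def] d_def[abs_def] using x g by (auto intro: borel_measurable_traj_pair)
  note [measurable] = borel_measurable_h_sq[OF abar]
  obtain R1 where R1: "\<And>t. t \<in> {0..T} \<Longrightarrow> norm (y t) \<le> R1"
    unfolding y_def by (rule trajectories_bounded[OF x]) blast
  obtain R2 where R2: "\<And>t. t \<in> {0..T} \<Longrightarrow> norm (d t) \<le> R2"
    unfolding d_def by (rule trajectories_bounded[OF g]) blast
  define R where "R = max R1 R2"
  have R: "norm (y t) \<le> R" "norm (d t) \<le> R" if "t \<in> {0..T}" for t
    using R1[OF that] R2[OF that] by (auto simp: R_def)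
  obtain C where C: "\<And>y d \<alpha>. norm y \<le> R \<Longrightarrow> norm d \<le> R \<Longrightarrow> 0 < \<alpha> \<Longrightarrow> \<alpha> \<le> 1 \<Longrightarrow>
    \<bar>h_sq A I abar (y + \<alpha> *\<^sub>R d) - h_sq A I abar y\<bar> \<le> C * \<alpha>"
    by (rule h_sq_increment_bound[OF abar]) blast
  \<comment> \<open>At \<alpha> = 0 both sides are 0, since division by 0 gives 0.\<close>
  have quot: "(phi A I abar T (\<lambda>t. x t + \<alpha> *\<^sub>R g t) - phi A I abar T x) / \<alpha> =
      (\<integral>t. (h_sq A I abar (y t + \<alpha> *\<^sub>R d t) - h_sq A I abar (y t)) / \<alpha> \<partial>?M)" for \<alpha>
  proof (cases "\<alpha> = 0")
    case False
    have eq: "traj_deriv T (\<lambda>t. x t + \<alpha> *\<^sub>R g t) t = traj_deriv T x t + \<alpha> *\<^sub>R traj_deriv T g t"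
      if "t \<in> {0..T}" for t
      using trajectories_scaleR[OF _ g, of \<alpha>] that
      by (simp add: traj_deriv_add[OF x] traj_deriv_scaleR[OF g])
    have "phi A I abar T (\<lambda>t. x t + \<alpha> *\<^sub>R g t) = (\<integral>t. h_sq A I abar (y t + \<alpha> *\<^sub>R d t) \<partial>?M)"
      unfolding phi_def by (rule Bochner_Integration.integral_cong) (auto simp: y_def d_def eq)
    moreover have "integrable ?M (\<lambda>t. h_sq A I abar (y t + \<alpha> *\<^sub>R d t))"
    proof (rule integrable_h_sq[OF abar])
      show "norm (y t + \<alpha> *\<^sub>R d t) \<le> R + \<bar>\<alpha>\<bar> * R" if "t \<in> {0..T}" for t
        using R[OF that] by (intro norm_triangle_le add_mono) (auto intro!: mult_left_mono)
    qed measurable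
    moreover have "integrable ?M (\<lambda>t. h_sq A I abar (y t))"
      by (rule integrable_h_sq[OF abar y_meas R(1)])
    moreover have "phi A I abar T x = (\<integral>t. h_sq A I abar (y t) \<partial>?M)"
      by (simp add: phi_def y_def)
    ultimately show ?thesis
      by simp
  qed simp
  show ?thesis
    unfolding quot y_def[symmetric] d_def[symmetric]
  \<comment> \<open>Dominated convergence concerns sequences; those in (0,1) suffice and stay in the
    range of steps covered by the increment bound.\<close>
  proof (rule tendsto_at_right_sequentially[of 0 1])
    fix S :: "nat \<Rightarrow> real"
    assume S: "\<And>n. 0 < S n" "\<And>n. S n < 1" "S \<longlonglongrightarrow> 0"
    show "(\<lambda>n. \<integral>t. (h_sq A I abar (y t + S n *\<^sub>R d t) - h_sq A I abar (y t)) / S n \<partial>?M) \<longlonglongrightarrow>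
      (\<integral>t. dir_deriv A (radius I abar) (y t) (d t) \<partial>?M)"
    proof (rule integral_dominated_convergence[where w="\<lambda>_. C"])
      show "(\<lambda>t. dir_deriv A (radius I abar) (y t) (d t)) \<in> borel_measurable ?M"
        using trajectories_measurable[OF g] unfolding dir_deriv_def d_def fst_conv snd_conv by measurable
      show "AE t in ?M. (\<lambda>n. (h_sq A I abar (y t + S n *\<^sub>R d t) - h_sq A I abar (y t)) / S n)
          \<longlonglongrightarrow> dir_deriv A (radius I abar) (y t) (d t)"
      proof (intro AE_I2 filterlim_compose[OF h_sq_dir_deriv[OF abar]])
        show "filterlim S (at_right 0) sequentially"
          by (intro tendsto_imp_filterlim_at_right S(3) always_eventually allI S(1))
      qed
      show "AE t in ?M. norm ((h_sq A I abar (y t + S n *\<^sub>R d t) - h_sq A I abar (y t)) / S n) \<le> C" for n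
      proof (rule AE_I2)
        fix t assume "t \<in> space ?M"
        then have t: "t \<in> {0..T}" by simp
        show "norm ((h_sq A I abar (y t + S n *\<^sub>R d t) - h_sq A I abar (y t)) / S n) \<le> C"
          using C[OF R[OF t] S(1) less_imp_le[OF S(2)], of n] S(1)[of n]
          by (simp add: abs_divide field_simps)
      qed
    qed auto
  qed simp
qed

theorem theorem6p1:
  fixes A :: "real^'n^'n" and I :: "'n set" and abar :: "'n \<Rightarrow> real"
    and T :: real and x :: "real \<Rightarrow> real^'n"
  assumes "T > 0"
    and "\<forall>i\<in>I. abar i > 0"
    and "x \<in> trajectories T"
    and "finitely_many_sign_intervals T x"
  shows "is_functional_superdifferential T (phi A I abar T) x
           (phi_superdifferential A I abar T x)"
proof -
  define b where "b = radius I abar"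
  let ?y = "\<lambda>t. (x t, traj_deriv T x t)"
  have b: "0 \<le> b i" for i using radius_nonneg[OF assms(2)] by (simp add: b_def)
  note mem = superdifferential_coeffs_L_infinity[OF b assms(3), of A]
  have r0: "0 \<le> spread A b (?y t) $ j" for t j
    by (rule spread_nonneg) (rule b)
  show ?thesis
    unfolding is_functional_superdifferential_def
      phi_superdifferential_eq_band[OF assms(1-3)] b_def[symmetric]
  proof (intro conjI ballI)
    let ?W = "band T (\<lambda>t. grad1 A b (?y t)) (\<lambda>t. spread A b (?y t)) (\<lambda>t. grad2 A b (?y t))"
    show "?W \<subseteq> traj_dual T" "compactin (weak_star_topology T) ?W"
      using compactin_band[OF assms(1) mem(1,3,2) r0] by auto
    show "convex_functionals T ?W"
      by (rule convex_functionals_band[OF mem(1,3,2)])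
    fix g :: "real \<Rightarrow> real^'n"
    assume g: "g \<in> trajectories T"
    show "\<exists>w. is_arg_min (\<lambda>v. v g) (\<lambda>v. v \<in> ?W) w \<and>
       ((\<lambda>\<alpha>. (phi A I abar T (\<lambda>t. x t + \<alpha> *\<^sub>R g t) - phi A I abar T x) / \<alpha>) \<longlongrightarrow> w g) (at_right 0)"
    proof (rule band_arg_min[OF mem(1,3,2) r0 g])
      fix w
      assume w: "is_arg_min (\<lambda>v. v g) (\<lambda>v. v \<in> ?W) w"
        "w g = (LINT t|lebesgue_on {0..T}. grad1 A b (?y t) \<bullet> g t + grad2 A b (?y t) \<bullet> traj_deriv T g t -
          (\<Sum>j\<in>UNIV. spread A b (?y t) $ j * \<bar>g t $ j\<bar>))"
      \<comment> \<open>The minimum over the band is the integral of \<open>dir_deriv\<close>, which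
        is the limit given by \<open>phi_dir_deriv\<close>.\<close>
      then have "w g = (LINT t|lebesgue_on {0..T}. dir_deriv A b (?y t) (g t, traj_deriv T g t))"
        by (simp add: dir_deriv_def)
      then show ?thesis
        using w(1) phi_dir_deriv[OF assms(2,3) g, of A] unfolding b_def[symmetric] by auto
    qed
  qed
qed

end
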